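(* Consider the cache-aided combination network with both secure delivery and secure caching constraints described in the context, with relay cache size $0\le N\le \frac{D+\hat K}{r}$. Let $t\in\{0,1,\dots,\hat K-1\}$ and $$M=1+\frac{tD}{\hat K-t}\Big(1-\frac{rN}{D+\hat K}\Big).$$ Then, with user cache size $M$ and relay cache size $N$, the rate pair $$R_1^{sc}=\frac{\hat K\big(rND+(D+\hat K)(M+D-1)\big)}{r\big(rND+(D+\hat K)[D+(M-1)(\hat K+1)]\big)}\Big(1-\frac{Nr}{D+\hat K}\Big),\qquad R_2^{sc}=\frac1r$$ is achievable under both constraints simultaneously. Moreover, for fixed $N$, every point of the convex envelope of the resulting set of triples $(M,R_1^{sc},R_2^{sc})$ is achievable under both constraints.
   Context: Combination network: a server holds $D$ independent files $W_1,\dots,W_D$, each uniformly distributed over $F$ bits. There are $h$ relay nodes $\Gamma_1,\dots,\Gamma_h$ and $K=\binom{h}{r}$ end users ($r<h$); each user is connected to a distinct set of $r$ relays (one user per $r$-subset), so each relay is connected to $\hat K=\binom{h-1}{r-1}$ users; $\mathcal N(U_k)$ is the set of relays connected to user $k$. The server is connected to every relay; all links are noiseless unicast links. Assume $K\le D$. Each user has a cache of $MF$ bits, each relay a cache of $NF$ bits. Placement (before demands): relay caches $V_j$ and user caches $Z_k$ are functions of the files and of randomness (e.g., keys) independent of the files, $H(V_j)\le NF$, $H(Z_k)\le MF$. Delivery: user $k$ requests $W_{d_k}$ for arbitrary $\mathbf d\in\{1,\dots,D\}^K$; the server sends relay $\Gamma_i$ a signal $X_{i,\mathbf d}$ of $R_1F$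 bits; relay $\Gamma_i$ sends each connected user $k$ a signal $Y_{i,\mathbf d,k}$ of $R_2F$ bits, a function of $X_{i,\mathbf d}$, $V_i$, $\mathbf d$; user $k$ decodes from $Z_k$, $\mathbf d$ and $\{Y_{j,\mathbf d,k}:j\in\mathcal N(U_k)\}$. Secure delivery: with $\mathcal X,\mathcal Y$ the sets of all server and relay transmissions, $I(\mathcal X,\mathcal Y;W_1,\dots,W_D)<\delta$. Secure caching: with $\mathbf W_{-d_k}$ all files except $W_{d_k}$, $\max_{\mathbf d,k}I(\mathbf W_{-d_k};\{Y_{j,\mathbf d,k}:j\in\mathcal N(U_k)\},Z_k)<\delta$. A pair is achievable under both constraints if for every $\epsilon,\delta>0$ and all sufficiently large $F$ there is a scheme with these rates, $\max_{\mathbf d,k}P(\hat W_{d_k}\ne W_{d_k})<\epsilon$, and both secrecy conditions with $\delta$. *)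

theory Defs
  imports "HOL-Probability.Probability" "HOL-Library.FuncSet"
begin

definition ent :: "'a pmf \<Rightarrow> ('a \<Rightarrow> 'b) \<Rightarrow> real" where
  "ent P X = - (\<Sum>x\<in>set_pmf (map_pmf X P).
                   pmf (map_pmf X P) x * log 2 (pmf (map_pmf X P) x))"

definition mi :: "'a pmf \<Rightarrow> ('a \<Rightarrow> 'b) \<Rightarrow> ('a \<Rightarrow> 'c) \<Rightarrow> real" where
  "mi P X Y = ent P X + ent P Y - ent P (\<lambda>w. (X w, Y w))"

text \<open>Relays are 0..h-1; users are identified with the r-subsets of relays,
  user S being connected to the relays in S.\<close>
definition users :: "nat \<Rightarrow> nat \<Rightarrow> nat set set" where
  "users h r = {S. S \<subseteq> {..<h} \<and> card S = r}"

definition Khat :: "nat \<Rightarrow> nat \<Rightarrow> nat" where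
  "Khat h r = (h - 1) choose (r - 1)"

definition file_tuples :: "nat \<Rightarrow> nat \<Rightarrow> (nat \<Rightarrow> bool list) set" where
  "file_tuples D F = {w. (\<forall>i<D. length (w i) = F) \<and> (\<forall>i\<ge>D. w i = [])}"

definition demands :: "nat \<Rightarrow> nat \<Rightarrow> nat \<Rightarrow> (nat set \<Rightarrow> nat) set" where
  "demands h r D = users h r \<rightarrow>\<^sub>E {..<D}"

text \<open>A scheme for file size F. The sample point is (w, \<rho>): the files w and
  the randomness \<rho> (keys etc.), independent of the files, with distribution q.
  Vc j: cache of relay j; Zc S: cache of user S; Xs i d: server signal to relay i
  under demand d; Yf i d S x v: signal relay i sends to user S computed from the
  server signal x and the relay cache v; Dec S d z ys: decoder of user S.\<close>
definition scheme_ok ::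
  "nat \<Rightarrow> nat \<Rightarrow> nat \<Rightarrow> real \<Rightarrow> real \<Rightarrow> real \<Rightarrow> real \<Rightarrow> real \<Rightarrow> real \<Rightarrow> nat \<Rightarrow>
   nat pmf \<Rightarrow>
   (nat \<Rightarrow> (nat \<Rightarrow> bool list) \<times> nat \<Rightarrow> bool list) \<Rightarrow>
   (nat set \<Rightarrow> (nat \<Rightarrow> bool list) \<times> nat \<Rightarrow> bool list) \<Rightarrow>
   (nat \<Rightarrow> (nat set \<Rightarrow> nat) \<Rightarrow> (nat \<Rightarrow> bool list) \<times> nat \<Rightarrow> bool list) \<Rightarrow>
   (nat \<Rightarrow> (nat set \<Rightarrow> nat) \<Rightarrow> nat set \<Rightarrow> bool list \<Rightarrow> bool list \<Rightarrow> bool list) \<Rightarrow>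
   (nat set \<Rightarrow> (nat set \<Rightarrow> nat) \<Rightarrow> bool list \<Rightarrow> (nat \<Rightarrow> bool list) \<Rightarrow> bool list) \<Rightarrow> bool"
where
  "scheme_ok h r D M N R1 R2 \<epsilon> \<delta> F q Vc Zc Xs Yf Dec \<longleftrightarrow>
    (let P = pair_pmf (pmf_of_set (file_tuples D F)) q;
         Yv = (\<lambda>i d S \<omega>. Yf i d S (Xs i d \<omega>) (Vc i \<omega>));
         Rcv = (\<lambda>d S \<omega>. (\<lambda>j. if j \<in> S then Yv j d S \<omega> else []))
     in finite (set_pmf q)
      \<and> (\<forall>j<h. ent P (Vc j) \<le> N * real F)
      \<and> (\<forall>S\<in>users h r. ent P (Zc S) \<le> M * real F)
      \<and> (\<forall>d\<in>demands h r D. \<forall>i<h. \<forall>\<omega>. real (length (Xs i d \<omega>)) \<le> R1 * real F)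
      \<and> (\<forall>d\<in>demands h r D. \<forall>S\<in>users h r. \<forall>i\<in>S. \<forall>\<omega>.
            real (length (Yv i d S \<omega>)) \<le> R2 * real F)
      \<and> (\<forall>d\<in>demands h r D. \<forall>S\<in>users h r.
            measure_pmf.prob P {\<omega>. Dec S d (Zc S \<omega>) (Rcv d S \<omega>) \<noteq> fst \<omega> (d S)} < \<epsilon>)
      \<and> (\<forall>d\<in>demands h r D.
            mi P (\<lambda>\<omega>. ((\<lambda>i. if i < h then Xs i d \<omega> else []),
                        (\<lambda>(i, S). if i < h \<and> S \<in> users h r \<and> i \<in> S
                                  then Yv i d S \<omega> else [])))
                 fst < \<delta>)
      \<and> (\<forall>d\<in>demands h r D. \<forall>S\<in>users h r.
            mi P (\<lambda>\<omega>. (\<lambda>i. if i \<noteq> d S then fst \<omega> i else []))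
                 (\<lambda>\<omega>. (Rcv d S \<omega>, Zc S \<omega>)) < \<delta>))"

definition achievable_sc :: "nat \<Rightarrow> nat \<Rightarrow> nat \<Rightarrow> real \<Rightarrow> real \<Rightarrow> real \<Rightarrow> real \<Rightarrow> bool" where
  "achievable_sc h r D M N R1 R2 \<longleftrightarrow>
    (\<forall>\<epsilon>>0. \<forall>\<delta>>0. \<exists>F0. \<forall>F\<ge>F0. \<exists>q Vc Zc Xs Yf Dec.
       scheme_ok h r D M N R1 R2 \<epsilon> \<delta> F q Vc Zc Xs Yf Dec)"

definition M_sc :: "nat \<Rightarrow> nat \<Rightarrow> nat \<Rightarrow> real \<Rightarrow> nat \<Rightarrow> real" where
  "M_sc h r D N t = 1 + real t * real D / (real (Khat h r) - real t)
                        * (1 - real r * N / (real D + real (Khat h r)))"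

definition R1_sc :: "nat \<Rightarrow> nat \<Rightarrow> nat \<Rightarrow> real \<Rightarrow> real \<Rightarrow> real" where
  "R1_sc h r D N M =
    (let K = real (Khat h r); Dr = real D; rr = real r in
     K * (rr * N * Dr + (Dr + K) * (M + Dr - 1))
     / (rr * (rr * N * Dr + (Dr + K) * (Dr + (M - 1) * (K + 1))))
     * (1 - N * rr / (Dr + K)))"

end

theory Submission
  imports Defs "HOL-Computational_Algebra.Polynomial"
begin

text \<open>
  A fraction \<open>\<alpha> = 1 - r N / (D + K)\<close> of every file is delivered by the server and the rest from the relay
  caches; both parts are first spread over the relays by an \<open>(h, r)\<close> MDS code. A relay sends its cached
  coded symbol to each user under a one-time pad shared with that user. For the server part, the coded
  symbol of a relay is split by a ramp secret sharing scheme into shares indexed by the \<open>t\<close>-subsets of the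
  users of that relay; user \<open>S\<close> caches the shares indexed by subsets containing \<open>S\<close>, which reveal nothing,
  and each \<open>(t+1)\<close>-subset of users is served by one padded sum of shares. Points of the convex hull
  come from splitting the server part further according to the weights.

  Since the rates must hold exactly for every large \<open>F\<close>, symbols live in \<open>\<int>/m\<close> for a modulus \<open>m\<close> just below
  the real power of two that the rates allow. Files outside the range of the symbol alphabet have
  vanishing probability, which is absorbed in \<open>\<epsilon>\<close>; secrecy is perfect.
\<close>

section \<open>MDS codes and ramp secret sharing over \<open>\<int>/m\<close>\<close>

text \<open>Exact rates are the obstacle. Rounding a non-integral exponent \<open>c * F\<close> down
  to get an alphabet of size \<open>2 ^ k\<close> can lose a constant fraction of the alphabet, and
  decoding would then fail with a probability that does not vanish. A modulus lies within an
  additive constant of \<open>2 powr (c * F)\<close>, and interpolation works as soon as differences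
  of evaluation points are units; hence the coprimality hypotheses. The constants: a relay holds
  \<open>D\<close> coded symbols and \<open>K\<close> keys, each of a fraction
  \<open>(1 - \<alpha>) / r\<close> of a file, which forces
  \<open>(D + K) (1 - \<alpha>) / r = N\<close>. With \<open>n = K choose t\<close> shares and
  \<open>C = (K - 1) choose t\<close>, a user caches \<open>n - C\<close> shares per relay and file,
  exactly the secrecy threshold, of a secret as large as \<open>C\<close> shares;
  \<open>(n - C) / C = t / (K - t)\<close> gives the second term of \<open>M\<close>. The term 1 is
  a pad for everything a user receives: \<open>\<alpha>\<close> for the server part,
  \<open>1 - \<alpha>\<close> for the relay part. Secrecy is stated for every fixed pair of file
  tuples, so it survives any preprocessing of the files, in particular the restriction to the symbol
  alphabet.\<close>

lemma const_poly_dvd_of_roots_mod: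
  fixes p :: "int poly" and m :: int
  assumes "finite J" "p = 0 \<or> degree p < card J"
    and "\<And>x. x \<in> J \<Longrightarrow> m dvd poly p x"
    and "\<And>x y. x \<in> J \<Longrightarrow> y \<in> J \<Longrightarrow> x \<noteq> y \<Longrightarrow> coprime (x - y) m"
  shows "[:m:] dvd p"
  using assms
proof (induction J arbitrary: p rule: finite_induct)
  case empty
  then show ?case by simp
next
  case (insert c J)
  \<comment> \<open>Split off one linear factor: \<open>q\<close> has lower degree and, since every
    \<open>x - c\<close> is a unit modulo \<open>m\<close>, inherits the remaining roots. Units take
    the role that the absence of zero divisors has in the usual count of roots.\<close>
  define q where "q = synthetic_div p c"
  have p_eq: "p = [:- c, 1:] * q + [:poly p c:]"
    unfolding q_def by (rule synthetic_div_correct' [symmetric])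
  have "[:m:] dvd q"
  proof (rule insert.IH)
    show "q = 0 \<or> degree q < card J"
      using insert.prems(1) insert.hyps unfolding q_def
      by (auto simp: degree_synthetic_div synthetic_div_eq_0_iff)
  next
    fix x assume x: "x \<in> J"
    have "poly p x = (x - c) * poly q x + poly p c"
      by (subst p_eq) (simp add: algebra_simps)
    then have "m dvd (x - c) * poly q x"
      using insert.prems(2)[of x] insert.prems(2)[of c] x
      by (metis add_diff_cancel_right' dvd_diff insertCI)
    moreover have "coprime (x - c) m"
      using insert.prems(3)[of x c] insert.hyps x by auto
    ultimately show "m dvd poly q x"
      by (simp add: coprime_commute coprime_dvd_mult_right_iff)
  qed (use insert.prems(3) in auto)
  moreover have "[:m:] dvd [:poly p c:]"
    using insert.prems(2)[of c] by (simp add: const_poly_dvd_iff coeff_pCons split: nat.split)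
  ultimately show ?case
    by (subst p_eq) (intro dvd_add dvd_mult)
qed

text \<open>Reed-Solomon code: codewords are the values at \<open>0, 1, ..., card I - 1\<close> of
  the polynomials with \<open>n\<close> coefficients below \<open>m\<close>. Distinct points differ
  by less than \<open>card I\<close>, hence by units. The result is a set of codewords, not an
  encoder, so that any \<open>n\<close> coordinates may later serve as the free ones.\<close>

lemma mds_code_exists:
  fixes I :: "'i set" and m n :: nat
  assumes "finite I" "0 < m" and cop: "\<And>k. 0 < k \<Longrightarrow> k < card I \<Longrightarrow> coprime k m"
  obtains \<C> where "\<C> \<subseteq> I \<rightarrow>\<^sub>E {..<m}"
    and "\<And>J. J \<subseteq> I \<Longrightarrow> card J = n \<Longrightarrow> bij_betw (\<lambda>c. restrict c J) \<C> (J \<rightarrow>\<^sub>E {..<m})"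
proof -
  obtain pt where pt: "bij_betw pt I {0..<card I}"
    using ex_bij_betw_finite_nat[OF \<open>finite I\<close>] by blast
  define P where "P a = (\<Sum>k<n. monom (int (a k)) k)" for a :: "nat \<Rightarrow> nat"
  define cw where "cw a = (\<lambda>x\<in>I. nat (poly (P a) (int (pt x)) mod int m))" for a
  let ?A = "{..<n} \<rightarrow>\<^sub>E {..<m}"
  have coeff_P: "coeff (P a) k = (if k < n then int (a k) else 0)" for a k
    unfolding P_def by (simp add: coeff_sum)
  have cw_lt: "cw a \<in> I \<rightarrow>\<^sub>E {..<m}" for a
    using \<open>0 < m\<close> by (auto simp: cw_def nat_less_iff)
  have bij: "bij_betw (\<lambda>a. restrict (cw a) J) ?A (J \<rightarrow>\<^sub>E {..<m})"
    if J: "J \<subseteq> I" "card J = n" for J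
  proof -
    have finJ: "finite J" using J \<open>finite I\<close> finite_subset by blast
    have inj: "inj_on (\<lambda>a. restrict (cw a) J) ?A"
    proof (rule inj_onI)
      fix a b assume a: "a \<in> ?A" and b: "b \<in> ?A"
        and eq: "restrict (cw a) J = restrict (cw b) J"
      define p where "p = P a - P b"
      define L where "L = (\<lambda>x. int (pt x)) ` J"
      have inj_pt: "inj_on (\<lambda>x. int (pt x)) J"
        using pt J(1) by (auto simp: bij_betw_def inj_on_def)
      have "[:int m:] dvd p"
      proof (rule const_poly_dvd_of_roots_mod[where J = L])
        show "finite L" unfolding L_def using finJ by simp
        have "card L = n" unfolding L_def using card_image[OF inj_pt] J by simp
        show "p = 0 \<or> degree p < card L"
        proof (cases "p = 0")
          case False
          have "coeff p k = 0" if "k \<ge> n" for k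
            using that by (simp add: p_def coeff_P)
          then have "degree p < n"
            using False by (metis leading_coeff_0_iff not_le)
          then show ?thesis using \<open>card L = n\<close> by simp
        qed simp
      next
        fix y assume "y \<in> L"
        then obtain x where x: "x \<in> J" "y = int (pt x)" by (auto simp: L_def)
        have "cw a x = cw b x" using eq x(1) by (metis restrict_apply')
        then have "poly (P a) y mod int m = poly (P b) y mod int m"
          using x J(1) \<open>0 < m\<close> by (auto simp: cw_def subset_iff eq_nat_nat_iff)
        then show "int m dvd poly p y"
          by (simp add: p_def mod_eq_dvd_iff)
      next
        fix y z assume "y \<in> L" "z \<in> L" "y \<noteq> z"
        then obtain u v where uv: "u \<in> J" "v \<in> J" "y = int (pt u)" "z = int (pt v)"
          by (auto simp: L_def)
        have "pt u < card I" "pt v < card I"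
          using uv J(1) bij_betwE[OF pt] by (auto simp: subset_iff)
        then have "coprime (nat \<bar>y - z\<bar>) m"
          using \<open>y \<noteq> z\<close> uv by (intro cop) auto
        then show "coprime (y - z) (int m)"
          by (simp add: coprime_int_iff[symmetric])
      qed
      then have dv: "int m dvd coeff p k" for k
        by (simp add: const_poly_dvd_iff)
      show "a = b"
      proof (rule PiE_ext[OF a b])
        fix k assume k: "k \<in> {..<n}"
        then have "int (a k) mod int m = int (b k) mod int m"
          using dv[of k] by (simp add: p_def coeff_P mod_eq_dvd_iff)
        moreover have "a k < m" "b k < m" using a b k by auto
        ultimately show "a k = b k" by simp
      qed
    qed
    \<comment> \<open>Both sides have \<open>m ^ n\<close> elements, so surjectivity follows from
      injectivity by counting.\<close>
    have "(\<lambda>a. restrict (cw a) J) ` ?A \<subseteq> J \<rightarrow>\<^sub>E {..<m}"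
      using cw_lt J(1) by (fastforce simp: subset_iff)
    moreover have "card ((\<lambda>a. restrict (cw a) J) ` ?A) = card (J \<rightarrow>\<^sub>E {..<m})"
      using card_image[OF inj] finJ J by (simp add: card_PiE)
    ultimately have "(\<lambda>a. restrict (cw a) J) ` ?A = J \<rightarrow>\<^sub>E {..<m}"
      using finJ by (intro card_subset_eq) (auto intro: finite_PiE)
    then show ?thesis using inj by (simp add: bij_betw_def)
  qed
  show thesis
  proof (rule that[of "cw ` ?A"])
    show "cw ` ?A \<subseteq> I \<rightarrow>\<^sub>E {..<m}" using cw_lt by blast
    fix J assume J: "J \<subseteq> I" "card J = n"
    have "inj_on (\<lambda>c. restrict c J) (cw ` ?A)"
      using bij[OF J] by (intro inj_on_imageI) (simp add: bij_betw_def comp_def)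
    then show "bij_betw (\<lambda>c. restrict c J) (cw ` ?A) (J \<rightarrow>\<^sub>E {..<m})"
      using bij[OF J] by (simp add: bij_betw_def image_image)
  qed
qed

text \<open>A number below \<open>m ^ r\<close> indexes a codeword: restriction to any
  \<open>r\<close> coordinates shows that there are exactly \<open>m ^ r\<close> of them, and the
  \<open>r\<close> relays of a user determine the codeword. If \<open>r > h\<close> there are no
  users and a constant encoding will do.\<close>

lemma mds_encoding_exists:
  fixes h r m :: nat
  assumes "0 < m" "\<And>k. 0 < k \<Longrightarrow> k < h \<Longrightarrow> coprime k m"
  obtains enc :: "nat \<Rightarrow> nat \<Rightarrow> nat"
  where "\<And>a i. a < m ^ r \<Longrightarrow> i < h \<Longrightarrow> enc a i < m"
    and "\<And>S a b. S \<in> users h r \<Longrightarrow> a < m ^ r \<Longrightarrow> b < m ^ r \<Longrightarrow>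
           (\<And>i. i \<in> S \<Longrightarrow> enc a i = enc b i) \<Longrightarrow> a = b"
proof (cases "r \<le> h")
  case True
  obtain \<C> where C: "\<C> \<subseteq> {..<h} \<rightarrow>\<^sub>E {..<m}"
    and bij: "\<And>J. J \<subseteq> {..<h} \<Longrightarrow> card J = r \<Longrightarrow>
      bij_betw (\<lambda>c. restrict c J) \<C> (J \<rightarrow>\<^sub>E {..<m})"
    using mds_code_exists[of "{..<h}" m r] assms by auto
  have "card \<C> = m ^ r"
    using bij_betw_same_card[OF bij[of "{..<r}"]] True by (simp add: card_PiE)
  moreover have "finite \<C>" using C by (rule finite_subset) (auto intro: finite_PiE)
  ultimately obtain g where g: "bij_betw g {..<m ^ r} \<C>"
    by (metis bij_betw_iff_card card_lessThan finite_lessThan)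
  show thesis
  proof (rule that[of g])
    show "g a i < m" if "a < m ^ r" "i < h" for a i
      using bij_betwE[OF g] C that by blast
  next
    fix S a b assume *: "S \<in> users h r" "a < m ^ r" "b < m ^ r" "\<And>i. i \<in> S \<Longrightarrow> g a i = g b i"
    have "restrict (g a) S = restrict (g b) S" using *(4) by (auto simp: restrict_def)
    then have "g a = g b"
      using bij[of S] * bij_betwE[OF g] by (auto simp: users_def bij_betw_def inj_on_def)
    then show "a = b" using g * by (auto simp: bij_betw_def inj_on_def)
  qed
next
  case False
  then have "users h r = {}"
    by (auto simp: users_def) (metis card_lessThan card_mono finite_lessThan)
  then show thesis using that[of "\<lambda>_ _. 0"] \<open>0 < m\<close> by auto
qed

text \<open>The secret occupies \<open>C\<close> additional coordinates of an MDS code of length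
  \<open>n + C\<close> and dimension \<open>n = card \<T>\<close>. All \<open>n\<close> shares
  determine the codeword, hence the secret. Any \<open>n - C\<close> shares together with the secret
  are \<open>n\<close> free coordinates, so these shares take all values equally often whatever the
  secret is; the permutation in the last claim expresses this.\<close>

lemma ramp_sharing_exists:
  fixes \<T> :: "'i set" and C m :: nat
  assumes fin: "finite \<T>" and C: "C \<le> card \<T>" and m: "0 < m"
    and cop: "\<And>k. 0 < k \<Longrightarrow> k < card \<T> + C \<Longrightarrow> coprime k m"
  obtains sh :: "nat \<Rightarrow> nat \<Rightarrow> 'i \<Rightarrow> nat"
  where "\<And>e \<rho> T. e < m ^ C \<Longrightarrow> \<rho> < m ^ (card \<T> - C) \<Longrightarrow> T \<in> \<T> \<Longrightarrow> sh e \<rho> T < m"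
    and "\<And>e e' \<rho> \<rho>'. e < m ^ C \<Longrightarrow> e' < m ^ C \<Longrightarrow> \<rho> < m ^ (card \<T> - C) \<Longrightarrow>
      \<rho>' < m ^ (card \<T> - C) \<Longrightarrow> (\<And>T. T \<in> \<T> \<Longrightarrow> sh e \<rho> T = sh e' \<rho>' T) \<Longrightarrow> e = e'"
    and "\<And>B e e'. B \<subseteq> \<T> \<Longrightarrow> card B = card \<T> - C \<Longrightarrow> e < m ^ C \<Longrightarrow> e' < m ^ C \<Longrightarrow>
      \<exists>\<pi>. bij_betw \<pi> {..<m ^ (card \<T> - C)} {..<m ^ (card \<T> - C)} \<and>
        (\<forall>\<rho><m ^ (card \<T> - C). \<forall>T\<in>B. sh e' (\<pi> \<rho>) T = sh e \<rho> T)"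
proof -
  let ?n = "card \<T>" and ?R = "m ^ (card \<T> - C)"
  let ?I = "\<T> <+> {..<C}" and ?E = "Inr ` {..<C} :: ('i + nat) set"
  have "card ?I = ?n + C" using fin by (simp add: card_Plus)
  then obtain \<C> where \<C>: "\<C> \<subseteq> ?I \<rightarrow>\<^sub>E {..<m}"
    and bij: "\<And>J. J \<subseteq> ?I \<Longrightarrow> card J = ?n \<Longrightarrow>
      bij_betw (\<lambda>c. restrict c J) \<C> (J \<rightarrow>\<^sub>E {..<m})"
    using mds_code_exists[of ?I m ?n] fin m cop by auto
  have finC: "finite \<C>" using \<C> by (rule finite_subset) (auto intro!: finite_PiE fin)
  have cardE: "card ?E = C" by (simp add: card_image)
  then have "card (?E \<rightarrow>\<^sub>E {..<m}) = m ^ C" by (simp add: card_PiE)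
  then obtain b where b: "bij_betw b {..<m ^ C} (?E \<rightarrow>\<^sub>E {..<m})"
    by (metis bij_betw_iff_card card_lessThan finite_lessThan finite_PiE finite_imageI)
  define fiber where "fiber e = {c \<in> \<C>. restrict c ?E = b e}" for e
  have fib: "bij_betw (\<lambda>c. restrict c (Inl ` B)) (fiber e) (Inl ` B \<rightarrow>\<^sub>E {..<m})"
    if B: "B \<subseteq> \<T>" "card B = ?n - C" and e: "e < m ^ C" for B e
  proof (rule bij_betw_imageI)
    let ?J = "Inl ` B \<union> ?E"
    have "card ?J = ?n"
      using B C finite_subset[OF B(1) fin] cardE
      by (subst card_Un_disjoint) (auto simp: card_image)
    moreover have JI: "?J \<subseteq> ?I" using B by auto
    ultimately have J: "bij_betw (\<lambda>c. restrict c ?J) \<C> (?J \<rightarrow>\<^sub>E {..<m})"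
      using bij by blast
    show "inj_on (\<lambda>c. restrict c (Inl ` B)) (fiber e)"
    proof (rule inj_onI)
      fix c c' assume c: "c \<in> fiber e" "c' \<in> fiber e"
        and 1: "restrict c (Inl ` B) = restrict c' (Inl ` B)"
      have 2: "restrict c ?E = restrict c' ?E" using c by (simp add: fiber_def)
      have "c x = c' x" if "x \<in> ?J" for x
        using that fun_cong[OF 1, of x] fun_cong[OF 2, of x] by (auto simp: restrict_def split: if_splits)
      then have "restrict c ?J = restrict c' ?J" by (rule restrict_ext)
      then show "c = c'" using J c by (auto simp: fiber_def bij_betw_def inj_on_def)
    qed
    show "(\<lambda>c. restrict c (Inl ` B)) ` fiber e = Inl ` B \<rightarrow>\<^sub>E {..<m}"
    proof (intro equalityI subsetI)
      fix x assume "x \<in> (\<lambda>c. restrict c (Inl ` B)) ` fiber e"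
      then obtain c where c: "c \<in> \<C>" "x = restrict c (Inl ` B)" by (auto simp: fiber_def)
      show "x \<in> Inl ` B \<rightarrow>\<^sub>E {..<m}"
      proof
        fix y :: "'i + nat" assume "y \<in> Inl ` B"
        then show "x y \<in> {..<m}" using PiE_mem[of c ?I "\<lambda>_. {..<m}" y] \<C> c B by auto
      qed (use c in auto)
    next
      fix g assume g: "g \<in> (Inl ` B :: ('i + nat) set) \<rightarrow>\<^sub>E {..<m}"
      define f where "f = (\<lambda>x\<in>?J. if x \<in> ?E then b e x else g x)"
      have be: "b e \<in> ?E \<rightarrow>\<^sub>E {..<m}" using bij_betwE[OF b] e by blast
      have "f \<in> ?J \<rightarrow>\<^sub>E {..<m}"
        unfolding f_def using PiE_mem[OF be] PiE_mem[OF g] by (intro restrict_PiE_iff[THEN iffD2]) auto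
      then obtain c where c: "c \<in> \<C>" "restrict c ?J = f"
        unfolding bij_betw_imp_surj_on[OF J, symmetric] by blast
      have cx: "c x = (if x \<in> ?E then b e x else g x)" if "x \<in> ?J" for x
        using fun_cong[OF c(2), of x] that by (simp add: f_def)
      have "restrict c ?E = b e"
        using be cx by (auto simp: restrict_def PiE_def extensional_def)
      then have "c \<in> fiber e" using c by (simp add: fiber_def)
      moreover have "restrict c (Inl ` B) = g"
        using g cx by (auto simp: restrict_def PiE_def extensional_def)
      ultimately show "g \<in> (\<lambda>c. restrict c (Inl ` B)) ` fiber e" by blast
    qed
  qed
  \<comment> \<open>All fibers have the same size, so one range of randomness, independent of the
    secret, enumerates each of them.\<close>
  have "\<exists>\<beta>. bij_betw \<beta> {..<?R} (fiber e)" if e: "e < m ^ C" for e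
  proof -
    obtain B where B: "B \<subseteq> \<T>" "card B = ?n - C"
      using obtain_subset_with_card_n[OF diff_le_self] by metis
    have "card (fiber e) = ?R"
      using bij_betw_same_card[OF fib[OF B e]] B finite_subset[OF B(1) fin]
      by (simp add: card_PiE card_image)
    moreover have "finite (fiber e)" using finC by (simp add: fiber_def)
    ultimately show ?thesis by (metis bij_betw_iff_card card_lessThan finite_lessThan)
  qed
  then obtain \<beta> where \<beta>: "\<And>e. e < m ^ C \<Longrightarrow> bij_betw (\<beta> e) {..<?R} (fiber e)" by metis
  have \<beta>C: "\<beta> e \<rho> \<in> fiber e" if "e < m ^ C" "\<rho> < ?R" for e \<rho>
    using bij_betwE[OF \<beta>] that by blast
  show thesis
  proof (rule that[of "\<lambda>e \<rho> T. \<beta> e \<rho> (Inl T)"])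
    fix e \<rho> T assume "e < m ^ C" "\<rho> < ?R" "T \<in> \<T>"
    then show "\<beta> e \<rho> (Inl T) < m"
      using \<beta>C[of e \<rho>] \<C> by (auto simp: fiber_def dest!: subsetD PiE_mem[where x = "Inl T"])
  next
    fix e e' \<rho> \<rho>' assume *: "e < m ^ C" "e' < m ^ C" "\<rho> < ?R" "\<rho>' < ?R"
      and eq: "\<And>T. T \<in> \<T> \<Longrightarrow> \<beta> e \<rho> (Inl T) = \<beta> e' \<rho>' (Inl T)"
    have "restrict (\<beta> e \<rho>) (Inl ` \<T>) = restrict (\<beta> e' \<rho>') (Inl ` \<T>)"
      using eq by (intro restrict_ext) auto
    moreover have "bij_betw (\<lambda>c. restrict c (Inl ` \<T>)) \<C> (Inl ` \<T> \<rightarrow>\<^sub>E {..<m})"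
      by (rule bij) (auto simp: card_image)
    ultimately have "\<beta> e \<rho> = \<beta> e' \<rho>'"
      using \<beta>C * by (auto simp: bij_betw_def inj_on_def fiber_def)
    then have "b e = b e'" using \<beta>C * by (metis (mono_tags, lifting) fiber_def mem_Collect_eq)
    then show "e = e'" using b * by (auto simp: bij_betw_def inj_on_def)
  next
    fix B e e' assume B: "B \<subseteq> \<T>" "card B = ?n - C" and e: "e < m ^ C" "e' < m ^ C"
    define \<phi> where "\<phi> e = (\<lambda>\<rho>. restrict (\<beta> e \<rho>) (Inl ` B :: ('i + nat) set))" for e
    have \<phi>: "bij_betw (\<phi> e) {..<?R} (Inl ` B \<rightarrow>\<^sub>E {..<m})" if "e < m ^ C" for e
      using bij_betw_trans[OF \<beta>[OF that] fib[OF B that]] by (simp add: \<phi>_def comp_def)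
    \<comment> \<open>\<open>\<pi> \<rho>\<close> is the randomness under which \<open>e'\<close>
      produces on \<open>B\<close> the shares that \<open>e\<close> produces under
      \<open>\<rho>\<close>.\<close>
    define \<pi> where "\<pi> = inv_into {..<?R} (\<phi> e') \<circ> \<phi> e"
    have "bij_betw \<pi> {..<?R} {..<?R}"
      unfolding \<pi>_def by (rule bij_betw_trans[OF \<phi>[OF e(1)] bij_betw_inv_into[OF \<phi>[OF e(2)]]])
    moreover have "\<beta> e' (\<pi> \<rho>) (Inl T) = \<beta> e \<rho> (Inl T)" if "\<rho> < ?R" "T \<in> B" for \<rho> T
    proof -
      have "\<phi> e \<rho> \<in> \<phi> e' ` {..<?R}"
        using bij_betwE[OF \<phi>[OF e(1)]] bij_betw_imp_surj_on[OF \<phi>[OF e(2)]] that by simp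
      then have "\<phi> e' (\<pi> \<rho>) = \<phi> e \<rho>" unfolding \<pi>_def by (simp add: f_inv_into_f)
      then show ?thesis using that(2) unfolding \<phi>_def by (metis imageI restrict_apply')
    qed
    ultimately show "\<exists>\<pi>. bij_betw \<pi> {..<?R} {..<?R} \<and>
        (\<forall>\<rho><?R. \<forall>T\<in>B. \<beta> e' (\<pi> \<rho>) (Inl T) = \<beta> e \<rho> (Inl T))" by blast
  qed
qed

section \<open>Perfect schemes and their products\<close>

text \<open>A perfect scheme over abstract alphabets. Randomness is uniform on \<open>Q\<close>, so equality of two
  conditional laws is witnessed by a permutation of \<open>Q\<close>; relay maps and decoders are replaced by the
  functional dependences that make them exist.\<close>

locale perfect_scheme =
  fixes h r D :: nat and A :: "'f set" and Q :: "'q set"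
    and V :: "nat \<Rightarrow> (nat \<Rightarrow> 'f) \<Rightarrow> 'q \<Rightarrow> 'v"
    and Z :: "nat set \<Rightarrow> (nat \<Rightarrow> 'f) \<Rightarrow> 'q \<Rightarrow> 'z"
    and X :: "nat \<Rightarrow> (nat set \<Rightarrow> nat) \<Rightarrow> (nat \<Rightarrow> 'f) \<Rightarrow> 'q \<Rightarrow> 'x"
    and Y :: "nat \<Rightarrow> (nat set \<Rightarrow> nat) \<Rightarrow> nat set \<Rightarrow> (nat \<Rightarrow> 'f) \<Rightarrow> 'q \<Rightarrow> 'y"
  assumes finite_A: "finite A" and A_ne: "A \<noteq> {}"
    and finite_Q: "finite Q" and Q_ne: "Q \<noteq> {}"
    and relay_function: "\<And>d S i w w' q q'. \<lbrakk>d \<in> demands h r D; S \<in> users h r; i \<in> S;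
      w \<in> {..<D} \<rightarrow> A; w' \<in> {..<D} \<rightarrow> A; q \<in> Q; q' \<in> Q;
      X i d w q = X i d w' q'; V i w q = V i w' q'\<rbrakk> \<Longrightarrow> Y i d S w q = Y i d S w' q'"
    and decodable: "\<And>d S w w' q q'. \<lbrakk>d \<in> demands h r D; S \<in> users h r;
      w \<in> {..<D} \<rightarrow> A; w' \<in> {..<D} \<rightarrow> A; q \<in> Q; q' \<in> Q;
      Z S w q = Z S w' q'; \<forall>j\<in>S. Y j d S w q = Y j d S w' q'\<rbrakk> \<Longrightarrow> w (d S) = w' (d S)"
    and secure_delivery: "\<And>d w w'. \<lbrakk>d \<in> demands h r D; w \<in> {..<D} \<rightarrow> A; w' \<in> {..<D} \<rightarrow> A\<rbrakk> \<Longrightarrow>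
      \<exists>\<pi>. bij_betw \<pi> Q Q \<and> (\<forall>q\<in>Q. (\<forall>i<h. X i d w' (\<pi> q) = X i d w q) \<and>
        (\<forall>S\<in>users h r. \<forall>i\<in>S. Y i d S w' (\<pi> q) = Y i d S w q))"
    and secure_caching: "\<And>d S w w'. \<lbrakk>d \<in> demands h r D; S \<in> users h r;
      w \<in> {..<D} \<rightarrow> A; w' \<in> {..<D} \<rightarrow> A; w (d S) = w' (d S)\<rbrakk> \<Longrightarrow>
      \<exists>\<pi>. bij_betw \<pi> Q Q \<and> (\<forall>q\<in>Q. Z S w' (\<pi> q) = Z S w q \<and>
        (\<forall>j\<in>S. Y j d S w' (\<pi> q) = Y j d S w q))"

text \<open>Rates depend only on alphabet sizes. Natural numbers as the common alphabet type allow
  products over a finite index set to be formed by induction.\<close>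

definition perfect_sizes :: "nat \<Rightarrow> nat \<Rightarrow> nat \<Rightarrow> nat \<Rightarrow> nat \<Rightarrow> nat \<Rightarrow> nat \<Rightarrow> nat \<Rightarrow> bool" where
  "perfect_sizes h r D a nV nZ nX nY \<longleftrightarrow>
    (\<exists>(Q :: nat set) (V :: nat \<Rightarrow> (nat \<Rightarrow> nat) \<Rightarrow> nat \<Rightarrow> nat) (Z :: nat set \<Rightarrow> (nat \<Rightarrow> nat) \<Rightarrow> nat \<Rightarrow> nat)
        (X :: nat \<Rightarrow> (nat set \<Rightarrow> nat) \<Rightarrow> (nat \<Rightarrow> nat) \<Rightarrow> nat \<Rightarrow> nat)
        (Y :: nat \<Rightarrow> (nat set \<Rightarrow> nat) \<Rightarrow> nat set \<Rightarrow> (nat \<Rightarrow> nat) \<Rightarrow> nat \<Rightarrow> nat).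
      perfect_scheme h r D {..<a} Q V Z X Y \<and>
      (\<forall>w\<in>{..<D} \<rightarrow> {..<a}. \<forall>q\<in>Q.
         (\<forall>j<h. V j w q < nV) \<and> (\<forall>S\<in>users h r. Z S w q < nZ) \<and>
         (\<forall>d\<in>demands h r D. (\<forall>i<h. X i d w q < nX) \<and>
            (\<forall>S\<in>users h r. \<forall>i\<in>S. Y i d S w q < nY))))"

section \<open>Recoding into numeric alphabets, and schemes run side by side\<close>

lemma ex_inj_into_lessThan:
  assumes "finite B" "card B \<le> n"
  obtains f :: "'b \<Rightarrow> nat" where "inj_on f B" "\<And>x. x \<in> B \<Longrightarrow> f x < n"
proof -
  obtain f where "bij_betw f B {0..<card B}" using ex_bij_betw_finite_nat assms(1) by blast
  then show thesis
    using that[of f] assms(2) bij_betwE[of f B "{0..<card B}"] bij_betw_imp_inj_on[of f B]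
    by (metis atLeastLessThan_iff order_less_le_trans)
qed

lemma users_subset: "S \<in> users h r \<Longrightarrow> i \<in> S \<Longrightarrow> i < h"
  by (auto simp: users_def)

text \<open>The concrete schemes have function-valued alphabets that vary with the relay or the
  user. Injections into initial segments preserve functional dependence and equality of views; the
  permutations of the randomness are conjugated by an enumeration of \<open>Q\<close>.\<close>

lemma perfect_sizesI:
  fixes A :: "'a set" and Q :: "'b set"
    and SV :: "nat \<Rightarrow> 'd set" and SZ :: "nat set \<Rightarrow> 'e set"
    and SX :: "nat \<Rightarrow> 'f set" and SY :: "nat \<Rightarrow> nat set \<Rightarrow> 'g set"
  assumes "perfect_scheme h r D A Q V Z X Y" and "card A = a"
    and V: "\<And>j w q. j < h \<Longrightarrow> w \<in> {..<D} \<rightarrow> A \<Longrightarrow> q \<in> Q \<Longrightarrow> V j w q \<in> SV j"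
      "\<And>j. j < h \<Longrightarrow> finite (SV j) \<and> card (SV j) \<le> nV"
    and Z: "\<And>S w q. S \<in> users h r \<Longrightarrow> w \<in> {..<D} \<rightarrow> A \<Longrightarrow> q \<in> Q \<Longrightarrow> Z S w q \<in> SZ S"
      "\<And>S. S \<in> users h r \<Longrightarrow> finite (SZ S) \<and> card (SZ S) \<le> nZ"
    and X: "\<And>i d w q. i < h \<Longrightarrow> d \<in> demands h r D \<Longrightarrow> w \<in> {..<D} \<rightarrow> A \<Longrightarrow> q \<in> Q \<Longrightarrow> X i d w q \<in> SX i"
      "\<And>i. i < h \<Longrightarrow> finite (SX i) \<and> card (SX i) \<le> nX"
    and Y: "\<And>i d S w q. S \<in> users h r \<Longrightarrow> i \<in> S \<Longrightarrow> d \<in> demands h r D \<Longrightarrow>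
        w \<in> {..<D} \<rightarrow> A \<Longrightarrow> q \<in> Q \<Longrightarrow> Y i d S w q \<in> SY i S"
      "\<And>i S. S \<in> users h r \<Longrightarrow> i \<in> S \<Longrightarrow> finite (SY i S) \<and> card (SY i S) \<le> nY"
  shows "perfect_sizes h r D a nV nZ nX nY"
proof -
  interpret perfect_scheme h r D A Q V Z X Y by fact
  have "\<exists>f :: 'd \<Rightarrow> nat. inj_on f (SV j) \<and> (\<forall>x\<in>SV j. f x < nV)" if "j < h" for j
    using V(2)[OF that] ex_inj_into_lessThan by metis
  then obtain fV :: "nat \<Rightarrow> 'd \<Rightarrow> nat"
    where fV: "\<And>j. j < h \<Longrightarrow> inj_on (fV j) (SV j)" "\<And>j x. j < h \<Longrightarrow> x \<in> SV j \<Longrightarrow> fV j x < nV"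
    by metis
  have "\<exists>f :: 'e \<Rightarrow> nat. inj_on f (SZ S) \<and> (\<forall>x\<in>SZ S. f x < nZ)" if "S \<in> users h r" for S
    using Z(2)[OF that] ex_inj_into_lessThan by metis
  then obtain fZ :: "nat set \<Rightarrow> 'e \<Rightarrow> nat" where fZ: "\<And>S. S \<in> users h r \<Longrightarrow> inj_on (fZ S) (SZ S)"
      "\<And>S x. S \<in> users h r \<Longrightarrow> x \<in> SZ S \<Longrightarrow> fZ S x < nZ"
    by metis
  have "\<exists>f :: 'f \<Rightarrow> nat. inj_on f (SX i) \<and> (\<forall>x\<in>SX i. f x < nX)" if "i < h" for i
    using X(2)[OF that] ex_inj_into_lessThan by metis
  then obtain fX :: "nat \<Rightarrow> 'f \<Rightarrow> nat"
    where fX: "\<And>i. i < h \<Longrightarrow> inj_on (fX i) (SX i)" "\<And>i x. i < h \<Longrightarrow> x \<in> SX i \<Longrightarrow> fX i x < nX"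
    by metis
  have "\<exists>f :: 'g \<Rightarrow> nat. inj_on f (SY i S) \<and> (\<forall>x\<in>SY i S. f x < nY)"
    if "S \<in> users h r" "i \<in> S" for i S
    using Y(2)[OF that] ex_inj_into_lessThan by metis
  note exY = this
  define fY where "fY i S = (SOME f :: 'g \<Rightarrow> nat. inj_on f (SY i S) \<and> (\<forall>x\<in>SY i S. f x < nY))" for i S
  have fY: "inj_on (fY i S) (SY i S)" "x \<in> SY i S \<Longrightarrow> fY i S x < nY"
    if "S \<in> users h r" "i \<in> S" for i S x
    using someI_ex[OF exY[OF that]] unfolding fY_def by blast+
  obtain g where g: "bij_betw g {..<a} A"
    using ex_bij_betw_nat_finite[OF finite_A] \<open>card A = a\<close> by (metis atLeast0LessThan)
  define Q' where "Q' = {..<card Q}"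
  obtain k where k: "bij_betw k Q' Q"
    using ex_bij_betw_nat_finite[OF finite_Q] by (metis atLeast0LessThan Q'_def)
  have gw: "g \<circ> w \<in> {..<D} \<rightarrow> A" if "w \<in> {..<D} \<rightarrow> {..<a}" for w
    using that bij_betwE[OF g] by (auto simp: Pi_iff)
  have kq: "k q \<in> Q" if "q \<in> Q'" for q using that bij_betwE[OF k] by blast
  have conj_bij: "bij_betw (inv_into Q' k \<circ> \<pi> \<circ> k) Q' Q' \<and> (\<forall>q\<in>Q'. k ((inv_into Q' k \<circ> \<pi> \<circ> k) q) = \<pi> (k q))"
    if "bij_betw \<pi> Q Q" for \<pi>
  proof
    show "bij_betw (inv_into Q' k \<circ> \<pi> \<circ> k) Q' Q'"
      using k that bij_betw_inv_into bij_betw_trans by metis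
    show "\<forall>q\<in>Q'. k ((inv_into Q' k \<circ> \<pi> \<circ> k) q) = \<pi> (k q)"
      using that k by (auto simp: bij_betw_inv_into_right[OF k] bij_betwE kq)
  qed
  define V' where "V' j w q = fV j (V j (g \<circ> w) (k q))" for j w q
  define Z' where "Z' S w q = fZ S (Z S (g \<circ> w) (k q))" for S w q
  define X' where "X' i d w q = fX i (X i d (g \<circ> w) (k q))" for i d w q
  define Y' where "Y' i d S w q = fY i S (Y i d S (g \<circ> w) (k q))" for i d S w q
  have "perfect_scheme h r D {..<a} Q' V' Z' X' Y'"
  proof
    have "0 < a" unfolding \<open>card A = a\<close>[symmetric] using A_ne finite_A by (simp add: card_gt_0_iff)
    then show "{..<a} \<noteq> {}" by auto
    show "finite Q'" "Q' \<noteq> {}" using Q_ne finite_Q by (auto simp: Q'_def lessThan_empty_iff)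
  next
    fix d S i w w' q q'
    assume *: "d \<in> demands h r D" "S \<in> users h r" "i \<in> S" "w \<in> {..<D} \<rightarrow> {..<a}"
      "w' \<in> {..<D} \<rightarrow> {..<a}" "q \<in> Q'" "q' \<in> Q'" "X' i d w q = X' i d w' q'" "V' i w q = V' i w' q'"
    have i: "i < h" using * users_subset by blast
    have "X i d (g \<circ> w) (k q) = X i d (g \<circ> w') (k q')"
      using inj_onD[OF fX(1)[OF i]] *(8) X(1)[OF i] gw kq * unfolding X'_def by blast
    moreover have "V i (g \<circ> w) (k q) = V i (g \<circ> w') (k q')"
      using inj_onD[OF fV(1)[OF i]] *(9) V(1)[OF i] gw kq * unfolding V'_def by blast
    ultimately show "Y' i d S w q = Y' i d S w' q'"
      unfolding Y'_def using relay_function[of d S i "g \<circ> w" "g \<circ> w'" "k q" "k q'"] * gw kq by metis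
  next
    fix d S w w' q q'
    assume *: "d \<in> demands h r D" "S \<in> users h r" "w \<in> {..<D} \<rightarrow> {..<a}"
      "w' \<in> {..<D} \<rightarrow> {..<a}" "q \<in> Q'" "q' \<in> Q'" "Z' S w q = Z' S w' q'"
      "\<forall>j\<in>S. Y' j d S w q = Y' j d S w' q'"
    have "Z S (g \<circ> w) (k q) = Z S (g \<circ> w') (k q')"
      using inj_onD[OF fZ(1)[OF *(2)]] *(7) Z(1)[OF *(2)] gw kq * unfolding Z'_def by blast
    moreover have "\<forall>j\<in>S. Y j d S (g \<circ> w) (k q) = Y j d S (g \<circ> w') (k q')"
      using inj_onD[OF fY(1)[OF *(2)]] *(8) Y(1)[OF *(2)] gw kq * unfolding Y'_def by blast
    ultimately have "(g \<circ> w) (d S) = (g \<circ> w') (d S)"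
      using decodable[of d S "g \<circ> w" "g \<circ> w'" "k q" "k q'"] * gw kq by blast
    moreover have "d S < D" using * by (auto simp: demands_def)
    ultimately show "w (d S) = w' (d S)"
      using * inj_onD[OF bij_betw_imp_inj_on[OF g]] by (auto simp: Pi_iff)
  next
    fix d w w' assume *: "d \<in> demands h r D" "w \<in> {..<D} \<rightarrow> {..<a}" "w' \<in> {..<D} \<rightarrow> {..<a}"
    obtain \<pi> where \<pi>: "bij_betw \<pi> Q Q" "\<forall>q\<in>Q. (\<forall>i<h. X i d (g \<circ> w') (\<pi> q) = X i d (g \<circ> w) q) \<and>
        (\<forall>S\<in>users h r. \<forall>i\<in>S. Y i d S (g \<circ> w') (\<pi> q) = Y i d S (g \<circ> w) q)"
      using secure_delivery[OF *(1) gw[OF *(2)] gw[OF *(3)]] by blast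
    show "\<exists>\<pi>. bij_betw \<pi> Q' Q' \<and> (\<forall>q\<in>Q'. (\<forall>i<h. X' i d w' (\<pi> q) = X' i d w q) \<and>
        (\<forall>S\<in>users h r. \<forall>i\<in>S. Y' i d S w' (\<pi> q) = Y' i d S w q))"
      using conj_bij[OF \<pi>(1)] \<pi>(2) kq unfolding X'_def Y'_def
      by (intro exI[of _ "inv_into Q' k \<circ> \<pi> \<circ> k"]) (metis (no_types, lifting))
  next
    fix d S w w' assume *: "d \<in> demands h r D" "S \<in> users h r" "w \<in> {..<D} \<rightarrow> {..<a}"
      "w' \<in> {..<D} \<rightarrow> {..<a}" "w (d S) = w' (d S)"
    obtain \<pi> where \<pi>: "bij_betw \<pi> Q Q" "\<forall>q\<in>Q. Z S (g \<circ> w') (\<pi> q) = Z S (g \<circ> w) q \<and>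
        (\<forall>j\<in>S. Y j d S (g \<circ> w') (\<pi> q) = Y j d S (g \<circ> w) q)"
      using secure_caching[OF *(1,2) gw[OF *(3)] gw[OF *(4)]] *(5) by auto
    show "\<exists>\<pi>. bij_betw \<pi> Q' Q' \<and> (\<forall>q\<in>Q'. Z' S w' (\<pi> q) = Z' S w q \<and>
        (\<forall>j\<in>S. Y' j d S w' (\<pi> q) = Y' j d S w q))"
      using conj_bij[OF \<pi>(1)] \<pi>(2) kq unfolding Z'_def Y'_def
      by (intro exI[of _ "inv_into Q' k \<circ> \<pi> \<circ> k"]) (metis (no_types, lifting))
  qed simp
  moreover have "\<forall>w\<in>{..<D} \<rightarrow> {..<a}. \<forall>q\<in>Q'.
         (\<forall>j<h. V' j w q < nV) \<and> (\<forall>S\<in>users h r. Z' S w q < nZ) \<and>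
         (\<forall>d\<in>demands h r D. (\<forall>i<h. X' i d w q < nX) \<and>
            (\<forall>S\<in>users h r. \<forall>i\<in>S. Y' i d S w q < nY))"
    using fV(2) V(1) fZ(2) Z(1) fX(2) X(1) fY(2) Y(1) gw kq
    unfolding V'_def Z'_def X'_def Y'_def by simp
  ultimately show ?thesis unfolding perfect_sizes_def by blast
qed

lemma perfect_sizes_one: "perfect_sizes h r D 1 1 1 1 1"
proof -
  have "perfect_scheme h r D {()} {()} (\<lambda>_ _ _. ()) (\<lambda>_ _ _. ()) (\<lambda>_ _ _ _. ()) (\<lambda>_ _ _ _ _. ())"
    by unfold_locales (auto intro!: exI[of _ id])
  then show ?thesis
    by (rule perfect_sizesI[where SV = "\<lambda>_. {()}" and SZ = "\<lambda>_. {()}" and SX = "\<lambda>_. {()}"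
          and SY = "\<lambda>_ _. {()}"]) auto
qed

lemma bij_betw_map_prod:
  assumes "bij_betw f A A'" "bij_betw g B B'"
  shows "bij_betw (map_prod f g) (A \<times> B) (A' \<times> B')"
  using assms by (auto simp: bij_betw_def map_prod_inj_on map_prod_surj_on)

text \<open>Each file is cut into two parts, served under the same demand with separate randomness.
  The product of the two permutations preserves the joint view, so secrecy is kept. Alphabet sizes
  multiply, that is, rates add.\<close>

lemma perfect_scheme_prod:
  assumes "perfect_scheme h r D A1 Q1 V1 Z1 X1 Y1" "perfect_scheme h r D A2 Q2 V2 Z2 X2 Y2"
  shows "perfect_scheme h r D (A1 \<times> A2) (Q1 \<times> Q2)
    (\<lambda>j w q. (V1 j (fst \<circ> w) (fst q), V2 j (snd \<circ> w) (snd q)))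
    (\<lambda>S w q. (Z1 S (fst \<circ> w) (fst q), Z2 S (snd \<circ> w) (snd q)))
    (\<lambda>i d w q. (X1 i d (fst \<circ> w) (fst q), X2 i d (snd \<circ> w) (snd q)))
    (\<lambda>i d S w q. (Y1 i d S (fst \<circ> w) (fst q), Y2 i d S (snd \<circ> w) (snd q)))"
proof -
  interpret p1: perfect_scheme h r D A1 Q1 V1 Z1 X1 Y1 by fact
  interpret p2: perfect_scheme h r D A2 Q2 V2 Z2 X2 Y2 by fact
  have w1: "fst \<circ> w \<in> {..<D} \<rightarrow> A1" if "w \<in> {..<D} \<rightarrow> A1 \<times> A2" for w
    using that by (auto simp: Pi_iff mem_Times_iff)
  have w2: "snd \<circ> w \<in> {..<D} \<rightarrow> A2" if "w \<in> {..<D} \<rightarrow> A1 \<times> A2" for w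
    using that by (auto simp: Pi_iff mem_Times_iff)
  show ?thesis
  proof
    show "finite (A1 \<times> A2)" "A1 \<times> A2 \<noteq> {}" "finite (Q1 \<times> Q2)" "Q1 \<times> Q2 \<noteq> {}"
      using p1.finite_A p2.finite_A p1.A_ne p2.A_ne p1.finite_Q p2.finite_Q p1.Q_ne p2.Q_ne by auto
  next
    fix d S i w w' q q'
    assume *: "d \<in> demands h r D" "S \<in> users h r" "i \<in> S" "w \<in> {..<D} \<rightarrow> A1 \<times> A2"
      "w' \<in> {..<D} \<rightarrow> A1 \<times> A2" "q \<in> Q1 \<times> Q2" "q' \<in> Q1 \<times> Q2"
      "(X1 i d (fst \<circ> w) (fst q), X2 i d (snd \<circ> w) (snd q)) =
        (X1 i d (fst \<circ> w') (fst q'), X2 i d (snd \<circ> w') (snd q'))"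
      "(V1 i (fst \<circ> w) (fst q), V2 i (snd \<circ> w) (snd q)) =
        (V1 i (fst \<circ> w') (fst q'), V2 i (snd \<circ> w') (snd q'))"
    then show "(Y1 i d S (fst \<circ> w) (fst q), Y2 i d S (snd \<circ> w) (snd q)) =
        (Y1 i d S (fst \<circ> w') (fst q'), Y2 i d S (snd \<circ> w') (snd q'))"
      using p1.relay_function[of d S i "fst \<circ> w" "fst \<circ> w'" "fst q" "fst q'"] w1
        p2.relay_function[of d S i "snd \<circ> w" "snd \<circ> w'" "snd q" "snd q'"] w2
      by (auto simp: mem_Times_iff)
  next
    fix d S w w' q q'
    assume *: "d \<in> demands h r D" "S \<in> users h r" "w \<in> {..<D} \<rightarrow> A1 \<times> A2"
      "w' \<in> {..<D} \<rightarrow> A1 \<times> A2" "q \<in> Q1 \<times> Q2" "q' \<in> Q1 \<times> Q2"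
      "(Z1 S (fst \<circ> w) (fst q), Z2 S (snd \<circ> w) (snd q)) =
        (Z1 S (fst \<circ> w') (fst q'), Z2 S (snd \<circ> w') (snd q'))"
      "\<forall>j\<in>S. (Y1 j d S (fst \<circ> w) (fst q), Y2 j d S (snd \<circ> w) (snd q)) =
        (Y1 j d S (fst \<circ> w') (fst q'), Y2 j d S (snd \<circ> w') (snd q'))"
    have "(fst \<circ> w) (d S) = (fst \<circ> w') (d S)"
      using p1.decodable[of d S "fst \<circ> w" "fst \<circ> w'" "fst q" "fst q'"] * w1
      by (auto simp: mem_Times_iff)
    moreover have "(snd \<circ> w) (d S) = (snd \<circ> w') (d S)"
      using p2.decodable[of d S "snd \<circ> w" "snd \<circ> w'" "snd q" "snd q'"] * w2
      by (auto simp: mem_Times_iff)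
    ultimately show "w (d S) = w' (d S)" by (simp add: prod_eq_iff)
  next
    fix d w w' assume *: "d \<in> demands h r D" "w \<in> {..<D} \<rightarrow> A1 \<times> A2" "w' \<in> {..<D} \<rightarrow> A1 \<times> A2"
    from p1.secure_delivery[OF *(1) w1[OF *(2)] w1[OF *(3)]] obtain \<pi>1
      where 1: "bij_betw \<pi>1 Q1 Q1"
        "\<forall>q\<in>Q1. (\<forall>i<h. X1 i d (fst \<circ> w') (\<pi>1 q) = X1 i d (fst \<circ> w) q) \<and>
        (\<forall>S\<in>users h r. \<forall>i\<in>S. Y1 i d S (fst \<circ> w') (\<pi>1 q) = Y1 i d S (fst \<circ> w) q)" by blast
    from p2.secure_delivery[OF *(1) w2[OF *(2)] w2[OF *(3)]] obtain \<pi>2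
      where 2: "bij_betw \<pi>2 Q2 Q2"
        "\<forall>q\<in>Q2. (\<forall>i<h. X2 i d (snd \<circ> w') (\<pi>2 q) = X2 i d (snd \<circ> w) q) \<and>
        (\<forall>S\<in>users h r. \<forall>i\<in>S. Y2 i d S (snd \<circ> w') (\<pi>2 q) = Y2 i d S (snd \<circ> w) q)" by blast
    show "\<exists>\<pi>. bij_betw \<pi> (Q1 \<times> Q2) (Q1 \<times> Q2) \<and> (\<forall>q\<in>Q1 \<times> Q2.
        (\<forall>i<h. (X1 i d (fst \<circ> w') (fst (\<pi> q)), X2 i d (snd \<circ> w') (snd (\<pi> q))) =
           (X1 i d (fst \<circ> w) (fst q), X2 i d (snd \<circ> w) (snd q))) \<and>
        (\<forall>S\<in>users h r. \<forall>i\<in>S.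
           (Y1 i d S (fst \<circ> w') (fst (\<pi> q)), Y2 i d S (snd \<circ> w') (snd (\<pi> q))) =
           (Y1 i d S (fst \<circ> w) (fst q), Y2 i d S (snd \<circ> w) (snd q))))"
      using 1(2) 2(2) bij_betw_map_prod[OF 1(1) 2(1)]
      by (intro exI[of _ "map_prod \<pi>1 \<pi>2"]) auto
  next
    fix d S w w' assume *: "d \<in> demands h r D" "S \<in> users h r" "w \<in> {..<D} \<rightarrow> A1 \<times> A2"
      "w' \<in> {..<D} \<rightarrow> A1 \<times> A2" "w (d S) = w' (d S)"
    from p1.secure_caching[OF *(1,2) w1[OF *(3)] w1[OF *(4)]] *(5) obtain \<pi>1
      where 1: "bij_betw \<pi>1 Q1 Q1" "\<forall>q\<in>Q1. Z1 S (fst \<circ> w') (\<pi>1 q) = Z1 S (fst \<circ> w) q \<and>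
        (\<forall>j\<in>S. Y1 j d S (fst \<circ> w') (\<pi>1 q) = Y1 j d S (fst \<circ> w) q)" by auto
    from p2.secure_caching[OF *(1,2) w2[OF *(3)] w2[OF *(4)]] *(5) obtain \<pi>2
      where 2: "bij_betw \<pi>2 Q2 Q2" "\<forall>q\<in>Q2. Z2 S (snd \<circ> w') (\<pi>2 q) = Z2 S (snd \<circ> w) q \<and>
        (\<forall>j\<in>S. Y2 j d S (snd \<circ> w') (\<pi>2 q) = Y2 j d S (snd \<circ> w) q)" by auto
    show "\<exists>\<pi>. bij_betw \<pi> (Q1 \<times> Q2) (Q1 \<times> Q2) \<and> (\<forall>q\<in>Q1 \<times> Q2.
        (Z1 S (fst \<circ> w') (fst (\<pi> q)), Z2 S (snd \<circ> w') (snd (\<pi> q))) =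
           (Z1 S (fst \<circ> w) (fst q), Z2 S (snd \<circ> w) (snd q)) \<and>
        (\<forall>j\<in>S. (Y1 j d S (fst \<circ> w') (fst (\<pi> q)), Y2 j d S (snd \<circ> w') (snd (\<pi> q))) =
           (Y1 j d S (fst \<circ> w) (fst q), Y2 j d S (snd \<circ> w) (snd q))))"
      using 1(2) 2(2) bij_betw_map_prod[OF 1(1) 2(1)]
      by (intro exI[of _ "map_prod \<pi>1 \<pi>2"]) auto
  qed
qed

lemma perfect_sizes_mult:
  assumes "perfect_sizes h r D a1 nV1 nZ1 nX1 nY1" "perfect_sizes h r D a2 nV2 nZ2 nX2 nY2"
  shows "perfect_sizes h r D (a1 * a2) (nV1 * nV2) (nZ1 * nZ2) (nX1 * nX2) (nY1 * nY2)"
proof -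
  obtain Q1 :: "nat set" and V1 :: "nat \<Rightarrow> (nat \<Rightarrow> nat) \<Rightarrow> nat \<Rightarrow> nat"
    and Z1 :: "nat set \<Rightarrow> (nat \<Rightarrow> nat) \<Rightarrow> nat \<Rightarrow> nat"
    and X1 :: "nat \<Rightarrow> (nat set \<Rightarrow> nat) \<Rightarrow> (nat \<Rightarrow> nat) \<Rightarrow> nat \<Rightarrow> nat"
    and Y1 :: "nat \<Rightarrow> (nat set \<Rightarrow> nat) \<Rightarrow> nat set \<Rightarrow> (nat \<Rightarrow> nat) \<Rightarrow> nat \<Rightarrow> nat"
    where 1: "perfect_scheme h r D {..<a1} Q1 V1 Z1 X1 Y1"
      "\<forall>w\<in>{..<D} \<rightarrow> {..<a1}. \<forall>q\<in>Q1.
         (\<forall>j<h. V1 j w q < nV1) \<and> (\<forall>S\<in>users h r. Z1 S w q < nZ1) \<and>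
         (\<forall>d\<in>demands h r D. (\<forall>i<h. X1 i d w q < nX1) \<and>
            (\<forall>S\<in>users h r. \<forall>i\<in>S. Y1 i d S w q < nY1))"
    using assms(1) unfolding perfect_sizes_def by blast
  obtain Q2 :: "nat set" and V2 :: "nat \<Rightarrow> (nat \<Rightarrow> nat) \<Rightarrow> nat \<Rightarrow> nat"
    and Z2 :: "nat set \<Rightarrow> (nat \<Rightarrow> nat) \<Rightarrow> nat \<Rightarrow> nat"
    and X2 :: "nat \<Rightarrow> (nat set \<Rightarrow> nat) \<Rightarrow> (nat \<Rightarrow> nat) \<Rightarrow> nat \<Rightarrow> nat"
    and Y2 :: "nat \<Rightarrow> (nat set \<Rightarrow> nat) \<Rightarrow> nat set \<Rightarrow> (nat \<Rightarrow> nat) \<Rightarrow> nat \<Rightarrow> nat"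
    where 2: "perfect_scheme h r D {..<a2} Q2 V2 Z2 X2 Y2"
      "\<forall>w\<in>{..<D} \<rightarrow> {..<a2}. \<forall>q\<in>Q2.
         (\<forall>j<h. V2 j w q < nV2) \<and> (\<forall>S\<in>users h r. Z2 S w q < nZ2) \<and>
         (\<forall>d\<in>demands h r D. (\<forall>i<h. X2 i d w q < nX2) \<and>
            (\<forall>S\<in>users h r. \<forall>i\<in>S. Y2 i d S w q < nY2))"
    using assms(2) unfolding perfect_sizes_def by blast
  have w1: "fst \<circ> w \<in> {..<D} \<rightarrow> {..<a1}" if "w \<in> {..<D} \<rightarrow> {..<a1} \<times> {..<a2}" for w
    using that by (auto simp: Pi_iff mem_Times_iff)
  have w2: "snd \<circ> w \<in> {..<D} \<rightarrow> {..<a2}" if "w \<in> {..<D} \<rightarrow> {..<a1} \<times> {..<a2}" for w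
    using that by (auto simp: Pi_iff mem_Times_iff)
  show ?thesis
    by (rule perfect_sizesI[OF perfect_scheme_prod[OF 1(1) 2(1)], where
          SV = "\<lambda>_. {..<nV1} \<times> {..<nV2}" and SZ = "\<lambda>_. {..<nZ1} \<times> {..<nZ2}" and
          SX = "\<lambda>_. {..<nX1} \<times> {..<nX2}" and SY = "\<lambda>_ _. {..<nY1} \<times> {..<nY2}"])
      (use 1(2) 2(2) w1 w2 in \<open>auto simp: mem_Times_iff\<close>)
qed

lemma perfect_sizes_prod:
  assumes "finite I" "\<And>x. x \<in> I \<Longrightarrow> perfect_sizes h r D (a x) (nV x) (nZ x) (nX x) (nY x)"
  shows "perfect_sizes h r D (\<Prod>x\<in>I. a x) (\<Prod>x\<in>I. nV x) (\<Prod>x\<in>I. nZ x) (\<Prod>x\<in>I. nX x) (\<Prod>x\<in>I. nY x)"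
  using assms
proof (induction I rule: finite_induct)
  case empty
  show ?case using perfect_sizes_one by simp
next
  case (insert x I)
  have "perfect_sizes h r D (a x * prod a I) (nV x * prod nV I) (nZ x * prod nZ I)
    (nX x * prod nX I) (nY x * prod nY I)"
    by (rule perfect_sizes_mult) (use insert in auto)
  then show ?case using insert.hyps by simp
qed

section \<open>The two component schemes\<close>

definition relay_users :: "nat \<Rightarrow> nat \<Rightarrow> nat \<Rightarrow> nat set set" where
  "relay_users h r i = {S \<in> users h r. i \<in> S}"

lemma finite_users: "finite (users h r)"
  unfolding users_def by (rule finite_subset[of _ "Pow {..<h}"]) auto

lemma finite_relay_users: "finite (relay_users h r i)"
  using finite_users by (simp add: relay_users_def)

lemma card_subsets_containing:
  assumes "finite U" "x \<in> U"
  shows "card {B. B \<subseteq> U \<and> card B = Suc k \<and> x \<in> B} = (card U - 1) choose k"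
proof -
  have "bij_betw (insert x) {B. B \<subseteq> U - {x} \<and> card B = k} {B. B \<subseteq> U \<and> card B = Suc k \<and> x \<in> B}"
  proof (rule bij_betw_byWitness[where f' = "\<lambda>B. B - {x}"])
    show "insert x ` {B. B \<subseteq> U - {x} \<and> card B = k} \<subseteq> {B. B \<subseteq> U \<and> card B = Suc k \<and> x \<in> B}"
    proof safe
      fix B assume B: "B \<subseteq> U - {x}" and k: "k = card B"
      show "card (insert x B) = Suc (card B)"
        using B finite_subset[OF B] assms by (subst card_insert_disjoint) auto
    qed (use assms in auto)
  qed (auto simp: card_Diff_singleton)
  then have "card {B. B \<subseteq> U \<and> card B = Suc k \<and> x \<in> B} = card {B. B \<subseteq> U - {x} \<and> card B = k}"
    by (simp add: bij_betw_same_card)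
  also have "\<dots> = (card U - 1) choose k"
    using assms by (simp add: n_subsets)
  finally show ?thesis .
qed

lemma card_relay_users:
  assumes "0 < r" "i < h"
  shows "card (relay_users h r i) = Khat h r"
proof -
  have "relay_users h r i = {B. B \<subseteq> {..<h} \<and> card B = Suc (r - 1) \<and> i \<in> B}"
    using assms by (auto simp: relay_users_def users_def)
  then show ?thesis
    using card_subsets_containing[of "{..<h}" i "r - 1"] assms by (simp add: Khat_def)
qed

text \<open>Written as a difference because \<open>(card U - 1) choose (t - 1)\<close> on the
  naturals would give 1 instead of 0 for \<open>t = 0\<close>. It is also the form
  \<open>n - C\<close> of the sharing threshold.\<close>

lemma card_subsets_containing_diff:
  assumes "finite U" "x \<in> U"
  shows "card {T. T \<subseteq> U \<and> card T = t \<and> x \<in> T} = (card U choose t) - ((card U - 1) choose t)"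
proof -
  let ?A = "{T. T \<subseteq> U \<and> card T = t}" and ?B = "{T. T \<subseteq> U - {x} \<and> card T = t}"
  have "{T. T \<subseteq> U \<and> card T = t \<and> x \<in> T} = ?A - ?B" by auto
  moreover have "card (?A - ?B) = card ?A - card ?B"
    using assms by (intro card_Diff_subset) (auto intro: finite_subset[of _ "Pow (U - {x})"])
  ultimately show ?thesis using assms by (simp add: n_subsets)
qed

section \<open>Permutations of the randomness and one-time pads modulo \<open>m\<close>\<close>

lemma self_bij_betwI:
  assumes "finite A" "f ` A \<subseteq> A" "inj_on f A"
  shows "bij_betw f A A"
  using endo_inj_surj[OF assms] assms(3) by (simp add: bij_betw_def)

lemma add_mod_cancel:
  fixes a b c m :: nat
  assumes "a < m" "b < m" "(c + a) mod m = (c + b) mod m"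
  shows "a = b"
proof -
  have "(int c + int a) mod int m = (int c + int b) mod int m"
    using assms(3) by (metis of_nat_add of_nat_mod)
  then have "int a mod int m = int b mod int m" by (simp add: mod_eq_dvd_iff)
  then show ?thesis using assms by simp
qed

text \<open>Replacing the pad \<open>k\<close> by \<open>k + f - f'\<close> makes the message
  \<open>f'\<close> look like \<open>f\<close>. The summand \<open>m - f' mod m\<close> stands for
  \<open>- f'\<close> within the naturals.\<close>

lemma mod_shift_cancel:
  fixes k f f' m :: nat
  assumes "0 < m"
  shows "((k + (f + (m - f' mod m))) mod m + f') mod m = (k + f) mod m"
proof -
  have "((k + (f + (m - f' mod m))) mod m + f') mod m = (k + (f + (m - f' mod m)) + f' mod m) mod m"
    by (simp only: mod_add_left_eq mod_add_right_eq)
  also have "k + (f + (m - f' mod m)) + f' mod m = k + f + m"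
    using mod_less_divisor[OF assms, of f'] by linarith
  finally show ?thesis by simp
qed

text \<open>The shift may depend on the remaining randomness \<open>\<rho>\<close>, since the padded
  sums contain shares that do; as \<open>\<rho>\<close> itself is kept, the map stays
  injective.\<close>

lemma bij_betw_key_shift:
  fixes g :: "'b \<Rightarrow> 'i \<Rightarrow> nat"
  assumes "finite I" "finite R" "0 < m"
  shows "bij_betw (\<lambda>(\<kappa>, \<rho>). (\<lambda>x\<in>I. (\<kappa> x + g \<rho> x) mod m, \<rho>)) ((I \<rightarrow>\<^sub>E {..<m}) \<times> R) ((I \<rightarrow>\<^sub>E {..<m}) \<times> R)"
proof (rule self_bij_betwI)
  show "finite ((I \<rightarrow>\<^sub>E {..<m}) \<times> R)" using assms by (auto intro: finite_PiE)
  show "(\<lambda>(\<kappa>, \<rho>). (\<lambda>x\<in>I. (\<kappa> x + g \<rho> x) mod m, \<rho>)) ` ((I \<rightarrow>\<^sub>E {..<m}) \<times> R) \<subseteq> (I \<rightarrow>\<^sub>E {..<m}) \<times> R"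
    using assms by auto
  show "inj_on (\<lambda>(\<kappa>, \<rho>). (\<lambda>x\<in>I. (\<kappa> x + g \<rho> x) mod m, \<rho>)) ((I \<rightarrow>\<^sub>E {..<m}) \<times> R)"
  proof (rule inj_onI)
    fix x y assume x: "x \<in> (I \<rightarrow>\<^sub>E {..<m}) \<times> R" and y: "y \<in> (I \<rightarrow>\<^sub>E {..<m}) \<times> R"
      and xy: "(\<lambda>(\<kappa>, \<rho>). (\<lambda>x\<in>I. (\<kappa> x + g \<rho> x) mod m, \<rho>)) x = (\<lambda>(\<kappa>, \<rho>). (\<lambda>x\<in>I. (\<kappa> x + g \<rho> x) mod m, \<rho>)) y"
    obtain \<kappa> \<rho> \<kappa>' where xy_eq: "x = (\<kappa>, \<rho>)" "y = (\<kappa>', \<rho>)" using xy by (cases x; cases y) auto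
    have k: "\<kappa> \<in> I \<rightarrow>\<^sub>E {..<m}" "\<kappa>' \<in> I \<rightarrow>\<^sub>E {..<m}" using x y xy_eq by auto
    have eq: "(\<lambda>x\<in>I. (\<kappa> x + g \<rho> x) mod m) = (\<lambda>x\<in>I. (\<kappa>' x + g \<rho> x) mod m)" using xy xy_eq by simp
    have "\<kappa> = \<kappa>'"
    proof (rule PiE_ext[OF k])
      fix x assume x: "x \<in> I"
      have "(g \<rho> x + \<kappa> x) mod m = (g \<rho> x + \<kappa>' x) mod m"
        using fun_cong[OF eq, of x] x by (simp add: add.commute)
      then show "\<kappa> x = \<kappa>' x" 
        using add_mod_cancel[of "\<kappa> x" m "\<kappa>' x" "g \<rho> x"] k x by auto
    qed
    then show "x = y" using xy_eq by simp
  qed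
qed

text \<open>Serves the part of the files that the relays cache. A relay stores one coded symbol per
  file and one key per attached user, hence the exponent \<open>D + Khat h r\<close>; a user stores
  one key for each of its \<open>r\<close> relays; the server is silent, hence the alphabet of size
  1.\<close>

lemma relay_cached_scheme:
  assumes r: "0 < r" and m: "0 < m" and cop: "\<And>k. 0 < k \<Longrightarrow> k < h \<Longrightarrow> coprime k m"
  shows "perfect_sizes h r D (m ^ r) (m ^ (D + Khat h r)) (m ^ r) 1 m"
proof -
  obtain enc :: "nat \<Rightarrow> nat \<Rightarrow> nat"
    where enc: "\<And>a i. a < m ^ r \<Longrightarrow> i < h \<Longrightarrow> enc a i < m"
      and enc_inj: "\<And>S a b. S \<in> users h r \<Longrightarrow> a < m ^ r \<Longrightarrow> b < m ^ r \<Longrightarrow>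
           (\<And>i. i \<in> S \<Longrightarrow> enc a i = enc b i) \<Longrightarrow> a = b"
    using mds_encoding_exists[of m h r] m cop by blast
  define I where "I = (SIGMA i:{..<h}. relay_users h r i)"
  have I_iff: "(i, S) \<in> I \<longleftrightarrow> S \<in> users h r \<and> i \<in> S" for i S
    using users_subset by (auto simp: I_def relay_users_def)
  have finI: "finite I" unfolding I_def using finite_relay_users by blast
  \<comment> \<open>The trivial second factor gives \<open>Q\<close> the shape that
    \<open>bij_betw_key_shift\<close> expects.\<close>
  define Q where "Q = (I \<rightarrow>\<^sub>E {..<m}) \<times> {()}"
  define V where "V i w q = (\<lambda>n\<in>{..<D}. enc (w n) i, \<lambda>S\<in>relay_users h r i. fst q (i, S))"
    for i and w :: "nat \<Rightarrow> nat" and q :: "(nat \<times> nat set \<Rightarrow> nat) \<times> unit"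
  define Z where "Z S w q = (\<lambda>i\<in>S. fst q (i, S))"
    for S and w :: "nat \<Rightarrow> nat" and q :: "(nat \<times> nat set \<Rightarrow> nat) \<times> unit"
  define X where "X i d w q = ()"
    for i :: nat and d :: "nat set \<Rightarrow> nat" and w :: "nat \<Rightarrow> nat" and q :: "(nat \<times> nat set \<Rightarrow> nat) \<times> unit"
  define Y where "Y i d S w q = (fst q (i, S) + enc (w (d S)) i) mod m"
    for i :: nat and d :: "nat set \<Rightarrow> nat" and S and w :: "nat \<Rightarrow> nat"
      and q :: "(nat \<times> nat set \<Rightarrow> nat) \<times> unit"
  have dem: "d S < D" if "d \<in> demands h r D" "S \<in> users h r" for d S
    using that by (auto simp: demands_def)
  have key: "fst q (i, S) < m" if "q \<in> Q" "S \<in> users h r" "i \<in> S" for q i S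
    using that I_iff by (auto simp: Q_def)
  have "perfect_scheme h r D {..<m ^ r} Q V Z X Y"
  proof
    show "{..<m ^ r} \<noteq> {}" using m by (auto simp: lessThan_empty_iff)
    show "finite Q" using finI by (auto simp: Q_def intro: finite_PiE)
    show "Q \<noteq> {}" using m by (auto simp: Q_def PiE_eq_empty_iff lessThan_empty_iff)
  next
    fix d S i w w' q q'
    assume *: "d \<in> demands h r D" "S \<in> users h r" "i \<in> S" "V i w q = V i w' q'"
    have "fst (V i w q) (d S) = fst (V i w' q') (d S)" "snd (V i w q) S = snd (V i w' q') S"
      using *(4) by simp_all
    then have "enc (w (d S)) i = enc (w' (d S)) i" "fst q (i, S) = fst q' (i, S)"
      using dem[OF *(1,2)] *(2,3) by (simp_all add: V_def relay_users_def)
    then show "Y i d S w q = Y i d S w' q'" by (simp add: Y_def)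
  next
    fix d S w w' q q'
    assume *: "d \<in> demands h r D" "S \<in> users h r" "w \<in> {..<D} \<rightarrow> {..<m ^ r}"
      "w' \<in> {..<D} \<rightarrow> {..<m ^ r}" "q \<in> Q" "q' \<in> Q" "Z S w q = Z S w' q'"
      "\<forall>j\<in>S. Y j d S w q = Y j d S w' q'"
    have w: "w (d S) < m ^ r" "w' (d S) < m ^ r" using * dem by (auto simp: Pi_iff)
    show "w (d S) = w' (d S)"
    proof (rule enc_inj[OF *(2) w])
      fix i assume i: "i \<in> S"
      have "fst q (i, S) = fst q' (i, S)"
        using fun_cong[OF *(7), of i] i by (simp add: Z_def)
      then show "enc (w (d S)) i = enc (w' (d S)) i"
        using *(8) i enc[OF w(1)] enc[OF w(2)] users_subset[OF *(2) i]
          add_mod_cancel[of "enc (w (d S)) i" m "enc (w' (d S)) i" "fst q (i, S)"]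
        by (auto simp: Y_def)
    qed
  next
    fix d :: "nat set \<Rightarrow> nat" and w w' :: "nat \<Rightarrow> nat"
    define g where "g = (\<lambda>(_::unit) (i, S). enc (w (d S)) i + (m - enc (w' (d S)) i mod m))"
    let ?\<pi> = "\<lambda>(\<kappa>, \<rho>). (\<lambda>x\<in>I. (\<kappa> x + g \<rho> x) mod m, \<rho>)"
    have "bij_betw ?\<pi> Q Q" unfolding Q_def using finI m by (intro bij_betw_key_shift) auto
    moreover have "Y i d S w' (?\<pi> q) = Y i d S w q" if "S \<in> users h r" "i \<in> S" "q \<in> Q" for S i q
      using that I_iff[of i S] mod_shift_cancel[OF m, of "fst q (i, S)"]
      by (auto simp: Y_def g_def split: prod.split)
    ultimately show "\<exists>\<pi>. bij_betw \<pi> Q Q \<and> (\<forall>q\<in>Q. (\<forall>i<h. X i d w' (\<pi> q) = X i d w q) \<and>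
        (\<forall>S\<in>users h r. \<forall>i\<in>S. Y i d S w' (\<pi> q) = Y i d S w q))"
      by (intro exI[of _ ?\<pi>]) (simp add: X_def)
  next
    \<comment> \<open>The keys and the requested file determine all that user \<open>S\<close> holds
      and receives, so the identity is a valid permutation.\<close>
    fix d and S :: "nat set" and w w' :: "nat \<Rightarrow> nat" assume "w (d S) = w' (d S)"
    then show "\<exists>\<pi>. bij_betw \<pi> Q Q \<and> (\<forall>q\<in>Q. Z S w' (\<pi> q) = Z S w q \<and>
        (\<forall>j\<in>S. Y j d S w' (\<pi> q) = Y j d S w q))"
      by (intro exI[of _ id]) (simp add: Z_def Y_def)
  qed simp
  then show ?thesis
  proof (rule perfect_sizesI[where SX = "\<lambda>_. {()}" and SY = "\<lambda>_ _. {..<m}"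
        and SZ = "\<lambda>S. S \<rightarrow>\<^sub>E {..<m}"
        and SV = "\<lambda>i. ({..<D} \<rightarrow>\<^sub>E {..<m}) \<times> (relay_users h r i \<rightarrow>\<^sub>E {..<m})"])
    fix j w q assume *: "j < h" "w \<in> {..<D} \<rightarrow> {..<m ^ r}" "q \<in> Q"
    then show "V j w q \<in> ({..<D} \<rightarrow>\<^sub>E {..<m}) \<times> (relay_users h r j \<rightarrow>\<^sub>E {..<m})"
      using enc key by (auto simp: V_def Pi_iff relay_users_def)
  next
    fix j assume "j < h"
    then show "finite (({..<D} \<rightarrow>\<^sub>E {..<m}) \<times> (relay_users h r j \<rightarrow>\<^sub>E {..<m})) \<and>
      card (({..<D} \<rightarrow>\<^sub>E {..<m}) \<times> (relay_users h r j \<rightarrow>\<^sub>E {..<m})) \<le> m ^ (D + Khat h r)"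
      using finite_relay_users card_relay_users[OF r]
      by (auto simp: card_cartesian_product card_PiE power_add intro!: finite_PiE)
  next
    fix S assume "S \<in> users h r"
    then show "finite (S \<rightarrow>\<^sub>E {..<m}) \<and> card (S \<rightarrow>\<^sub>E {..<m}) \<le> m ^ r"
      by (auto simp: users_def card_PiE finite_subset intro!: finite_PiE)
  qed (use key m in \<open>auto simp: Z_def X_def Y_def\<close>)
qed


lemma bij_betw_PiE_pointwise:
  assumes "finite I" "finite R" "\<And>x. x \<in> I \<Longrightarrow> bij_betw (p x) R R"
  shows "bij_betw (\<lambda>\<rho>. \<lambda>x\<in>I. p x (\<rho> x)) (I \<rightarrow>\<^sub>E R) (I \<rightarrow>\<^sub>E R)"
proof (rule self_bij_betwI)
  show "finite (I \<rightarrow>\<^sub>E R)" using assms by (auto intro: finite_PiE)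
  show "(\<lambda>\<rho>. \<lambda>x\<in>I. p x (\<rho> x)) ` (I \<rightarrow>\<^sub>E R) \<subseteq> I \<rightarrow>\<^sub>E R"
    using bij_betwE[OF assms(3)] by fastforce
  show "inj_on (\<lambda>\<rho>. \<lambda>x\<in>I. p x (\<rho> x)) (I \<rightarrow>\<^sub>E R)"
  proof (rule inj_onI)
    fix a b assume ab: "a \<in> I \<rightarrow>\<^sub>E R" "b \<in> I \<rightarrow>\<^sub>E R"
      and eq: "(\<lambda>x\<in>I. p x (a x)) = (\<lambda>x\<in>I. p x (b x))"
    show "a = b"
    proof (rule PiE_ext[OF ab])
      fix x assume x: "x \<in> I"
      have "p x (a x) = p x (b x)" using fun_cong[OF eq, of x] x by simp
      then show "a x = b x"
        using inj_onD[OF bij_betw_imp_inj_on[OF assms(3)[OF x]]] ab x by blast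
    qed
  qed
qed

text \<open>Exponents count symbols modulo \<open>m\<close>. The coded symbol of a relay is a secret
  of \<open>C\<close> symbols, split into \<open>n\<close> shares. A user lacks the \<open>C\<close>
  shares indexed by sets without it and recovers one from each of the \<open>C\<close> groups of
  size \<open>t + 1\<close> that contain it. It caches the other \<open>n - C\<close> shares of all
  \<open>D\<close> files and one pad per group, hence \<open>D * (n - C) + C\<close> at each of its
  \<open>r\<close> relays. The bound \<open>h + n + C\<close> covers the \<open>h\<close> points of
  the relay code and the \<open>n + C\<close> points of the sharing code.\<close>

lemma coded_multicast_scheme:
  fixes h r D t m :: nat
  defines "K \<equiv> Khat h r"
  defines "C \<equiv> (K - 1) choose t" and "n \<equiv> K choose t"
  assumes r: "0 < r" and m: "0 < m"
    and cop: "\<And>k. 0 < k \<Longrightarrow> k < h + n + C \<Longrightarrow> coprime k m"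
  shows "perfect_sizes h r D ((m ^ C) ^ r) 1 (m ^ (r * (D * (n - C) + C))) (m ^ (K choose Suc t)) (m ^ C)"
proof -
  define U where "U = relay_users h r"
  define TT where "TT i = {T. T \<subseteq> U i \<and> card T = t}" for i
  define BB where "BB i = {B. B \<subseteq> U i \<and> card B = Suc t}" for i
  \<comment> \<open>\<open>st\<close> indexes the shares that user \<open>S\<close> caches,
    \<open>sB\<close> the groups whose padded sums it receives.\<close>
  define st where "st i S = {T \<in> TT i. S \<in> T}" for i S
  define sB where "sB i S = {B \<in> BB i. S \<in> B}" for i S
  define R where "R = m ^ (n - C)"
  have finU: "finite (U i)" for i by (simp add: U_def finite_relay_users)
  have cardU: "card (U i) = K" if "i < h" for i
    using card_relay_users[OF r that] by (simp add: U_def K_def)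
  have finT: "finite (TT i)" for i
    unfolding TT_def by (rule finite_subset[of _ "Pow (U i)"]) (use finU in auto)
  have finB: "finite (BB i)" for i
    unfolding BB_def by (rule finite_subset[of _ "Pow (U i)"]) (use finU in auto)
  have fin_sub: "finite B" if "B \<in> BB i \<or> B \<in> TT i" for B i
    using that finite_subset[OF _ finU[of i], of B] by (auto simp: BB_def TT_def)
  have cardT: "card (TT i) = n" if "i < h" for i
    using cardU[OF that] finU by (simp add: TT_def n_subsets n_def)
  have cardB: "card (BB i) = K choose Suc t" if "i < h" for i
    using cardU[OF that] finU by (simp add: BB_def n_subsets)
  have inU: "S \<in> U i \<longleftrightarrow> S \<in> users h r \<and> i \<in> S" for S i
    by (simp add: U_def relay_users_def)
  have card_st: "card (st i S) = n - C" if "S \<in> users h r" "i \<in> S" for i S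
  proof -
    have "st i S = {T. T \<subseteq> U i \<and> card T = t \<and> S \<in> T}" by (auto simp: st_def TT_def)
    then show ?thesis
      using card_subsets_containing_diff[OF finU, of S i t] that inU cardU users_subset
      by (auto simp: n_def C_def)
  qed
  have card_sB: "card (sB i S) = C" if "S \<in> users h r" "i \<in> S" for i S
  proof -
    have "sB i S = {B. B \<subseteq> U i \<and> card B = Suc t \<and> S \<in> B}" by (auto simp: sB_def BB_def)
    then show ?thesis
      using card_subsets_containing[OF finU, of S i t] that inU cardU users_subset
      by (auto simp: C_def)
  qed
  have Cn: "C \<le> n" unfolding C_def n_def by (rule binomial_right_mono) simp
  have mC: "0 < m ^ C" using m by simp
  \<comment> \<open>The relay code works modulo \<open>m ^ C\<close>, because its symbols are the
    secrets to be shared; units modulo \<open>m\<close> remain units there.\<close>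
  have cop_mC: "coprime k (m ^ C)" if "0 < k" "k < h" for k using cop that by simp
  obtain enc :: "nat \<Rightarrow> nat \<Rightarrow> nat"
    where enc: "\<And>a i. a < (m ^ C) ^ r \<Longrightarrow> i < h \<Longrightarrow> enc a i < m ^ C"
      and enc_inj: "\<And>S a b. S \<in> users h r \<Longrightarrow> a < (m ^ C) ^ r \<Longrightarrow> b < (m ^ C) ^ r \<Longrightarrow>
           (\<And>i. i \<in> S \<Longrightarrow> enc a i = enc b i) \<Longrightarrow> a = b"
    using mds_encoding_exists[OF mC cop_mC] by blast
  define shares where "shares i f \<longleftrightarrow> (\<forall>e<m ^ C. \<forall>\<rho><R. \<forall>T\<in>TT i. f e \<rho> T < m) \<and>
      (\<forall>e<m ^ C. \<forall>e'<m ^ C. \<forall>\<rho><R. \<forall>\<rho>'<R. (\<forall>T\<in>TT i. f e \<rho> T = f e' \<rho>' T) \<longrightarrow> e = e') \<and>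
      (\<forall>B\<subseteq>TT i. card B = n - C \<longrightarrow> (\<forall>e<m ^ C. \<forall>e'<m ^ C.
         \<exists>\<pi>. bij_betw \<pi> {..<R} {..<R} \<and> (\<forall>\<rho><R. \<forall>T\<in>B. f e' (\<pi> \<rho>) T = f e \<rho> T)))"
    for i and f :: "nat \<Rightarrow> nat \<Rightarrow> nat set set \<Rightarrow> nat"
  have "\<exists>f. shares i f" if ih: "i < h" for i
  proof (rule ramp_sharing_exists[of "TT i" C m, unfolded cardT[OF ih] R_def[symmetric]])
    show "finite (TT i)" "C \<le> n" "0 < m" using finT Cn m by auto
    show "coprime k m" if "0 < k" "k < n + C" for k using cop that by simp
  next
    fix f :: "nat \<Rightarrow> nat \<Rightarrow> nat set set \<Rightarrow> nat"
    assume *: "\<And>e \<rho> T. e < m ^ C \<Longrightarrow> \<rho> < R \<Longrightarrow> T \<in> TT i \<Longrightarrow> f e \<rho> T < m"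
      "\<And>e e' \<rho> \<rho>'. e < m ^ C \<Longrightarrow> e' < m ^ C \<Longrightarrow> \<rho> < R \<Longrightarrow> \<rho>' < R \<Longrightarrow>
        (\<And>T. T \<in> TT i \<Longrightarrow> f e \<rho> T = f e' \<rho>' T) \<Longrightarrow> e = e'"
      "\<And>B e e'. B \<subseteq> TT i \<Longrightarrow> card B = n - C \<Longrightarrow> e < m ^ C \<Longrightarrow> e' < m ^ C \<Longrightarrow>
        \<exists>\<pi>. bij_betw \<pi> {..<R} {..<R} \<and> (\<forall>\<rho><R. \<forall>T\<in>B. f e' (\<pi> \<rho>) T = f e \<rho> T)"
    have "shares i f"
      unfolding shares_def
    proof (intro conjI)
      show "\<forall>e<m ^ C. \<forall>\<rho><R. \<forall>T\<in>TT i. f e \<rho> T < m" using *(1) by blast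
      show "\<forall>e<m ^ C. \<forall>e'<m ^ C. \<forall>\<rho><R. \<forall>\<rho>'<R. (\<forall>T\<in>TT i. f e \<rho> T = f e' \<rho>' T) \<longrightarrow> e = e'"
        using *(2) by presburger
      show "\<forall>B\<subseteq>TT i. card B = n - C \<longrightarrow> (\<forall>e<m ^ C. \<forall>e'<m ^ C.
        \<exists>\<pi>. bij_betw \<pi> {..<R} {..<R} \<and> (\<forall>\<rho><R. \<forall>T\<in>B. f e' (\<pi> \<rho>) T = f e \<rho> T))"
        using *(3) by (intro allI impI) auto
    qed
    then show ?thesis by blast
  qed
  then obtain sh :: "nat \<Rightarrow> nat \<Rightarrow> nat \<Rightarrow> nat set set \<Rightarrow> nat" where sh: "\<And>i. i < h \<Longrightarrow> shares i (sh i)"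
    by metis
  have sh_lt: "sh i e \<rho> T < m" if "i < h" "e < m ^ C" "\<rho> < R" "T \<in> TT i" for i e \<rho> T
    using sh[OF that(1), unfolded shares_def, THEN conjunct1] that(2-) by simp
  have sh_inj: "e = e'" if "i < h" "e < m ^ C" "e' < m ^ C" "\<rho> < R" "\<rho>' < R"
    "\<And>T. T \<in> TT i \<Longrightarrow> sh i e \<rho> T = sh i e' \<rho>' T" for i e e' \<rho> \<rho>'
    using sh[OF that(1), unfolded shares_def, THEN conjunct2, THEN conjunct1, rule_format] that(2-) by simp
  have sh_sec: "\<exists>\<pi>. bij_betw \<pi> {..<R} {..<R} \<and> (\<forall>\<rho><R. \<forall>T\<in>B. sh i e' (\<pi> \<rho>) T = sh i e \<rho> T)"
    if "i < h" "B \<subseteq> TT i" "card B = n - C" "e < m ^ C" "e' < m ^ C" for i B e e'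
    using sh[OF that(1), unfolded shares_def, THEN conjunct2, THEN conjunct2] that(2-) by simp

  define I where "I = (SIGMA i:{..<h}. BB i)"
  define J where "J = {..<h} \<times> {..<D}"
  \<comment> \<open>One pad per relay and group, and one sharing randomness per relay and
    file.\<close>
  define Q where "Q = (I \<rightarrow>\<^sub>E {..<m}) \<times> (J \<rightarrow>\<^sub>E {..<R})"
  define s where "s i w \<rho> l T = sh i (enc (w l) i) (\<rho> (i, l)) T"
    for i and w :: "nat \<Rightarrow> nat" and \<rho> :: "nat \<times> nat \<Rightarrow> nat" and l T
  \<comment> \<open>The summand of \<open>u\<close> is a share of the file requested by
    \<open>u\<close>, indexed by the other members of the group: \<open>u\<close> lacks it, and all
    the others cache it.\<close>
  define sm where "sm i d w \<rho> B = (\<Sum>u\<in>B. s i w \<rho> (d u) (B - {u}))"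
    for i and d :: "nat set \<Rightarrow> nat" and w \<rho> B
  define V where "V i w q = ()"
    for i :: nat and w :: "nat \<Rightarrow> nat" and q :: "(nat \<times> nat set set \<Rightarrow> nat) \<times> (nat \<times> nat \<Rightarrow> nat)"
  define Z where "Z S w q = (\<lambda>(i, l, T)\<in>(SIGMA i:S. {..<D} \<times> st i S). s i w (snd q) l T,
      \<lambda>(i, B)\<in>(SIGMA i:S. sB i S). fst q (i, B))"
    for S and w :: "nat \<Rightarrow> nat" and q :: "(nat \<times> nat set set \<Rightarrow> nat) \<times> (nat \<times> nat \<Rightarrow> nat)"
  define X where "X i d w q = (\<lambda>B\<in>BB i. (fst q (i, B) + sm i d w (snd q) B) mod m)"
    for i d w and q :: "(nat \<times> nat set set \<Rightarrow> nat) \<times> (nat \<times> nat \<Rightarrow> nat)"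
  define Y where "Y i d S w q = restrict (X i d w q) (sB i S)"
    for i d S w and q :: "(nat \<times> nat set set \<Rightarrow> nat) \<times> (nat \<times> nat \<Rightarrow> nat)"
  let ?W = "{..<D} \<rightarrow> {..<(m ^ C) ^ r}"
  have finI: "finite I" unfolding I_def using finB by blast
  have finJ: "finite J" by (simp add: J_def)
  have R: "0 < R" using m by (simp add: R_def)
  have dem: "d S < D" if "d \<in> demands h r D" "S \<in> users h r" for d S
    using that by (auto simp: demands_def)
  have encw: "enc (w l) i < m ^ C" if "w \<in> ?W" "l < D" "i < h" for w l i
    using that enc by (auto simp: Pi_iff)
  have rho: "snd q (i, l) < R" if "q \<in> Q" "i < h" "l < D" for q i l
    using that by (auto simp: Q_def J_def)
  have key: "fst q (i, B) < m" if "q \<in> Q" "i < h" "B \<in> BB i" for q i B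
    using that by (auto simp: Q_def I_def)
  have s_lt: "s i w (snd q) l T < m" if "w \<in> ?W" "q \<in> Q" "i < h" "l < D" "T \<in> TT i" for i w q l T
    unfolding s_def using that by (intro sh_lt encw rho)
  have Z_eqD: "s i w (snd q) l T = s i w' (snd q') l T"
    if "Z S w q = Z S w' q'" "i \<in> S" "l < D" "T \<in> st i S" for S w q w' q' i l T
  proof -
    have "fst (Z S w q) (i, l, T) = fst (Z S w' q') (i, l, T)" using that(1) by simp
    then show ?thesis using that(2-) by (simp add: Z_def)
  qed
  have Z_eqD': "fst q (i, B) = fst q' (i, B)"
    if "Z S w q = Z S w' q'" "i \<in> S" "B \<in> sB i S" for S w q w' q' i B
  proof -
    have "snd (Z S w q) (i, B) = snd (Z S w' q') (i, B)" using that(1) by simp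
    then show ?thesis using that(2-) by (simp add: Z_def)
  qed
  have Bsub: "B - {u} \<in> TT i" if "B \<in> BB i" "u \<in> B" for B u i
  proof -
    have "card (B - {u}) = t" using that by (simp add: BB_def card_Diff_singleton)
    moreover have "B - {u} \<subseteq> U i" using that(1) unfolding BB_def by blast
    ultimately show ?thesis unfolding TT_def by simp
  qed
  have BU: "u \<in> users h r" if "B \<in> BB i" "u \<in> B" for B u i
    using that inU[of u i] unfolding BB_def by blast
  have ps: "perfect_scheme h r D {..<(m ^ C) ^ r} Q V Z X Y"
  proof
    show "{..<(m ^ C) ^ r} \<noteq> {}" using m by (auto simp: lessThan_empty_iff)
    show "finite Q" unfolding Q_def using finI finJ by (intro finite_cartesian_product finite_PiE) auto
    show "Q \<noteq> {}" using m R by (simp add: Q_def PiE_eq_empty_iff lessThan_empty_iff)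
  next
    fix d S i w w' q q' assume "X i d w q = X i d w' q'"
    then show "Y i d S w q = Y i d S w' q'" by (simp add: Y_def)
  next
    fix d S w w' q q'
    assume d: "d \<in> demands h r D" and S: "S \<in> users h r" and w: "w \<in> ?W" "w' \<in> ?W"
      and q: "q \<in> Q" "q' \<in> Q" and Z: "Z S w q = Z S w' q'"
      and Y: "\<forall>j\<in>S. Y j d S w q = Y j d S w' q'"
    have dS: "d S < D" using dem d S .
    show "w (d S) = w' (d S)"
    proof (rule enc_inj[OF S])
      show "w (d S) < (m ^ C) ^ r" "w' (d S) < (m ^ C) ^ r" using w dS by (auto simp: Pi_iff)
      fix i assume i: "i \<in> S"
      have ih: "i < h" using users_subset[OF S i] .
      show "enc (w (d S)) i = enc (w' (d S)) i"
      proof (rule sh_inj[OF ih encw[OF w(1) dS ih] encw[OF w(2) dS ih] rho[OF q(1) ih dS] rho[OF q(2) ih dS]])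
        fix T assume T: "T \<in> TT i"
        have "s i w (snd q) (d S) T = s i w' (snd q') (d S) T"
        proof (cases "S \<in> T")
          case True
          then show ?thesis using Z_eqD[OF Z i dS] T by (simp add: st_def)
        next
          case False
          \<comment> \<open>The missing share \<open>T\<close> arrives in the group
            \<open>insert S T\<close>. Every other summand is indexed by a set containing
            \<open>S\<close>, hence cached, and the pad is cached as well.\<close>
          define B where "B = insert S T"
          have finT': "finite T" using fin_sub T by blast
          have B: "B \<in> BB i" "B \<in> sB i S"
            using T False finT' inU S i by (auto simp: B_def BB_def TT_def sB_def)
          have sm: "sm i d w \<rho> B = s i w \<rho> (d S) T + (\<Sum>u\<in>T. s i w \<rho> (d u) (B - {u}))" for w \<rho>
            unfolding sm_def B_def using False finT' by simp
          have rest: "(\<Sum>u\<in>T. s i w (snd q) (d u) (B - {u})) = (\<Sum>u\<in>T. s i w' (snd q') (d u) (B - {u}))"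
          proof (rule sum.cong[OF refl])
            fix u assume u: "u \<in> T"
            then have "B - {u} \<in> st i S" using Bsub[OF B(1), of u] False by (auto simp: st_def B_def)
            moreover have "d u < D" using dem[OF d BU[OF B(1)]] u by (simp add: B_def)
            ultimately show "s i w (snd q) (d u) (B - {u}) = s i w' (snd q') (d u) (B - {u})"
              using Z_eqD[OF Z i] by blast
          qed
          have "Y i d S w q B = Y i d S w' q' B" using Y i by simp
          then have "(fst q (i, B) + sm i d w (snd q) B) mod m = (fst q' (i, B) + sm i d w' (snd q') B) mod m"
            using B by (simp add: Y_def X_def)
          then show ?thesis
            using Z_eqD'[OF Z i B(2)] rest s_lt[OF w(1) q(1) ih dS T] s_lt[OF w(2) q(2) ih dS T]
              add_mod_cancel[of "s i w (snd q) (d S) T" m "s i w' (snd q') (d S) T"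
                "fst q (i, B) + (\<Sum>u\<in>T. s i w (snd q) (d u) (B - {u}))"]
            unfolding sm by (simp add: ac_simps)
        qed
        then show "sh i (enc (w (d S)) i) (snd q (i, d S)) T = sh i (enc (w' (d S)) i) (snd q' (i, d S)) T"
          by (simp add: s_def)
      qed
    qed
  next
    fix d w w'
    \<comment> \<open>Each pad protects a single sum, so shifting the pads absorbs any change of the
      files while the sharing randomness stays.\<close>
    define g where "g = (\<lambda>\<rho> (i, B). sm i d w \<rho> B + (m - sm i d w' \<rho> B mod m))"
    let ?\<pi> = "\<lambda>(\<kappa>, \<rho>). (\<lambda>x\<in>I. (\<kappa> x + g \<rho> x) mod m, \<rho>)"
    have "bij_betw ?\<pi> Q Q"
      unfolding Q_def using finI finJ m by (intro bij_betw_key_shift) (auto intro: finite_PiE)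
    moreover have X: "X i d w' (?\<pi> q) = X i d w q" if "i < h" for i q
    proof -
      obtain \<kappa> \<rho> where q: "q = (\<kappa>, \<rho>)" by fastforce
      show ?thesis
        using that mod_shift_cancel[OF m] by (auto simp: q X_def g_def I_def intro!: restrict_ext)
    qed
    moreover have "Y i d S w' (?\<pi> q) = Y i d S w q" if "S \<in> users h r" "i \<in> S" for i S q
      unfolding Y_def using X[OF users_subset[OF that]] by simp
    ultimately show "\<exists>\<pi>. bij_betw \<pi> Q Q \<and> (\<forall>q\<in>Q. (\<forall>i<h. X i d w' (\<pi> q) = X i d w q) \<and>
        (\<forall>S\<in>users h r. \<forall>i\<in>S. Y i d S w' (\<pi> q) = Y i d S w q))"
      by (intro exI[of _ ?\<pi>]) simp
  next
    fix d S w w'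
    assume d: "d \<in> demands h r D" and S: "S \<in> users h r" and w: "w \<in> ?W" "w' \<in> ?W"
      and eq: "w (d S) = w' (d S)"
    \<comment> \<open>The cached index sets number exactly \<open>n - C\<close>, the threshold of
      the sharing, so the randomness of each file can be exchanged without altering a cached
      share.\<close>
    have "\<exists>\<pi>. bij_betw \<pi> {..<R} {..<R} \<and>
        (\<forall>\<rho><R. \<forall>T\<in>st i S. sh i (enc (w' l) i) (\<pi> \<rho>) T = sh i (enc (w l) i) \<rho> T)"
      if "i \<in> S" "l < D" for i l
      using that users_subset[OF S] by (intro sh_sec card_st S encw w) (auto simp: st_def)
    then have "\<exists>\<pi>. i \<in> S \<longrightarrow> l < D \<longrightarrow> bij_betw \<pi> {..<R} {..<R} \<and>
        (\<forall>\<rho><R. \<forall>T\<in>st i S. sh i (enc (w' l) i) (\<pi> \<rho>) T = sh i (enc (w l) i) \<rho> T)" for i l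
      by blast
    then obtain p where p: "\<And>i l. i \<in> S \<Longrightarrow> l < D \<Longrightarrow> bij_betw (p i l) {..<R} {..<R}"
      "\<And>i l \<rho> T. i \<in> S \<Longrightarrow> l < D \<Longrightarrow> \<rho> < R \<Longrightarrow> T \<in> st i S \<Longrightarrow>
         sh i (enc (w' l) i) (p i l \<rho>) T = sh i (enc (w l) i) \<rho> T"
      by metis
    \<comment> \<open>The requested file is the same in \<open>w\<close> and \<open>w'\<close> and
      keeps its randomness, so even its shares not cached by \<open>S\<close> are unchanged. Relays
      outside \<open>S\<close> do not enter the view.\<close>
    define p' where "p' = (\<lambda>(i, l). if i \<in> S \<and> l \<noteq> d S then p i l else id)"
    let ?\<pi> = "map_prod id (\<lambda>\<rho>. \<lambda>x\<in>J. p' x (\<rho> x)) :: _ \<Rightarrow> (nat \<times> nat set set \<Rightarrow> nat) \<times> (nat \<times> nat \<Rightarrow> nat)"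
    have "bij_betw ?\<pi> Q Q"
      unfolding Q_def using finJ p(1)
      by (intro bij_betw_map_prod bij_betw_PiE_pointwise) (auto simp: p'_def J_def split: prod.split)
    moreover have s1: "s i w' (snd (?\<pi> q)) (d S) T = s i w (snd q) (d S) T"
      if "i \<in> S" for i q T
      using that eq dem[OF d S] users_subset[OF S that] by (simp add: s_def p'_def J_def)
    moreover have s2: "s i w' (snd (?\<pi> q)) l T = s i w (snd q) l T"
      if "i \<in> S" "l < D" "T \<in> st i S" "q \<in> Q" for i q l T
    proof (cases "l = d S")
      case True
      then show ?thesis using s1 that by simp
    next
      case False
      then show ?thesis
        using that users_subset[OF S that(1)] p(2)[OF that(1,2) rho[OF that(4)] that(3)]
        by (simp add: s_def p'_def J_def)
    qed
    have Z: "Z S w' (?\<pi> q) = Z S w q" if "q \<in> Q" for q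
      unfolding Z_def using s2 that by (cases q) (auto intro!: restrict_ext)
    have Y: "Y i d S w' (?\<pi> q) = Y i d S w q" if "i \<in> S" "q \<in> Q" for i q
    proof -
      \<comment> \<open>In a group containing \<open>S\<close>, the summand of \<open>S\<close>
        belongs to the requested file and every other summand is a share that \<open>S\<close>
        caches. With the pads fixed, the received sums therefore stay the same.\<close>
      have "sm i d w' (snd (?\<pi> q)) B = sm i d w (snd q) B" if B: "B \<in> sB i S" for B
        unfolding sm_def
      proof (rule sum.cong[OF refl])
        fix u assume u: "u \<in> B"
        have B': "B \<in> BB i" "S \<in> B" using B by (auto simp: sB_def)
        show "s i w' (snd (?\<pi> q)) (d u) (B - {u}) = s i w (snd q) (d u) (B - {u})"
        proof (cases "u = S")
          case True
          then show ?thesis using s1 \<open>i \<in> S\<close> by simp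
        next
          case False
          then have "B - {u} \<in> st i S" using Bsub[OF B'(1) u] B'(2) by (simp add: st_def)
          then show ?thesis using s2 \<open>i \<in> S\<close> \<open>q \<in> Q\<close> dem[OF d BU[OF B'(1) u]] by blast
        qed
      qed
      then show ?thesis unfolding Y_def X_def by (auto simp: sB_def intro!: restrict_ext)
    qed
    show "\<exists>\<pi>. bij_betw \<pi> Q Q \<and> (\<forall>q\<in>Q. Z S w' (\<pi> q) = Z S w q \<and>
        (\<forall>j\<in>S. Y j d S w' (\<pi> q) = Y j d S w q))"
      using \<open>bij_betw ?\<pi> Q Q\<close> Z Y by blast
  qed simp
  have cardS: "finite S" "card S = r" if "S \<in> users h r" for S
    using that by (auto simp: users_def finite_subset)
  have fin_st: "finite (st i S)" "finite (sB i S)" for i S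
    using finT finB by (auto simp: st_def sB_def)
  show ?thesis
  proof (rule perfect_sizesI[OF ps, where SV = "\<lambda>_. {()}" and SY = "\<lambda>i S. sB i S \<rightarrow>\<^sub>E {..<m}"
        and SX = "\<lambda>i. BB i \<rightarrow>\<^sub>E {..<m}"
        and SZ = "\<lambda>S. ((SIGMA i:S. {..<D} \<times> st i S) \<rightarrow>\<^sub>E {..<m}) \<times> ((SIGMA i:S. sB i S) \<rightarrow>\<^sub>E {..<m})"])
    fix S w q assume *: "S \<in> users h r" "w \<in> ?W" "q \<in> Q"
    then show "Z S w q \<in> ((SIGMA i:S. {..<D} \<times> st i S) \<rightarrow>\<^sub>E {..<m}) \<times> ((SIGMA i:S. sB i S) \<rightarrow>\<^sub>E {..<m})"
      using s_lt key users_subset[OF *(1)] by (cases q) (auto simp: Z_def st_def sB_def)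
  next
    fix S assume S: "S \<in> users h r"
    have fin: "finite (SIGMA i:S. {..<D} \<times> st i S)" "finite (SIGMA i:S. sB i S)"
      using cardS[OF S] fin_st by auto
    have "card (SIGMA i:S. {..<D} \<times> st i S) = (\<Sum>i\<in>S. D * (n - C))"
      using cardS[OF S] fin_st card_st[OF S] by (simp add: card_cartesian_product)
    moreover have "card (SIGMA i:S. sB i S) = (\<Sum>i\<in>S. C)"
      using cardS[OF S] fin_st card_sB[OF S] by simp
    ultimately show "finite (((SIGMA i:S. {..<D} \<times> st i S) \<rightarrow>\<^sub>E {..<m}) \<times> ((SIGMA i:S. sB i S) \<rightarrow>\<^sub>E {..<m})) \<and>
      card (((SIGMA i:S. {..<D} \<times> st i S) \<rightarrow>\<^sub>E {..<m}) \<times> ((SIGMA i:S. sB i S) \<rightarrow>\<^sub>E {..<m}))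
        \<le> m ^ (r * (D * (n - C) + C))"
      using fin cardS[OF S]
      by (auto simp: card_cartesian_product card_PiE power_add[symmetric] algebra_simps intro!: finite_PiE)
  next
    fix i assume "i < h"
    then show "finite (BB i \<rightarrow>\<^sub>E {..<m}) \<and> card (BB i \<rightarrow>\<^sub>E {..<m}) \<le> m ^ (K choose Suc t)"
      using finB cardB by (auto simp: card_PiE intro!: finite_PiE)
  next
    fix i S assume "S \<in> users h r" "i \<in> S"
    then show "finite (sB i S \<rightarrow>\<^sub>E {..<m}) \<and> card (sB i S \<rightarrow>\<^sub>E {..<m}) \<le> m ^ C"
      using fin_st card_sB by (auto simp: card_PiE intro!: finite_PiE)
  next
    show "X i d w q \<in> BB i \<rightarrow>\<^sub>E {..<m}" for i d w q
      unfolding X_def using m by (simp add: restrict_PiE_iff)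
    have "BB i \<inter> sB i S = sB i S" for i S by (auto simp: sB_def)
    then show "Y i d S w q \<in> sB i S \<rightarrow>\<^sub>E {..<m}" for i d S w q
      unfolding Y_def X_def using m by (simp add: restrict_PiE_iff)
  qed (simp_all add: V_def)
qed

section \<open>Entropy and independence\<close>

text \<open>Gibbs' inequality against the weight \<open>1 / n\<close>, from
  \<open>ln y \<le> y - 1\<close> at \<open>y = 1 / (n p)\<close> for each probability
  \<open>p\<close>.\<close>

lemma ent_le_log_card:
  assumes "finite B" "set_pmf (map_pmf X P) \<subseteq> B" "card B \<le> n"
  shows "ent P X \<le> log 2 (real n)"
proof -
  define Q where "Q = map_pmf X P"
  define S where "S = set_pmf Q"
  have S: "finite S" "S \<noteq> {}" "card S \<le> n"
    using assms finite_subset card_mono set_pmf_not_empty unfolding S_def Q_def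
    by (blast, blast, meson card_mono le_trans)
  then have n: "0 < n" by (metis card_gt_0_iff less_le_trans)
  have sum1: "(\<Sum>x\<in>S. pmf Q x) = 1" using S by (intro sum_pmf_eq_1) (auto simp: S_def)
  have "ent P X - log 2 n = (\<Sum>x\<in>S. - (pmf Q x * log 2 (pmf Q x)) - pmf Q x * log 2 n)"
    unfolding sum_subtractf sum_distrib_right[symmetric] sum1
    by (simp add: ent_def Q_def S_def sum_negf)
  also have "\<dots> \<le> (\<Sum>x\<in>S. (1 / n - pmf Q x) / ln 2)"
  proof (rule sum_mono)
    fix x assume "x \<in> S"
    then have p: "0 < pmf Q x" by (simp add: S_def pmf_positive)
    have "- (pmf Q x * log 2 (pmf Q x)) - pmf Q x * log 2 n = pmf Q x * ln (1 / (n * pmf Q x)) / ln 2"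
      using p n by (simp add: log_def ln_div ln_mult field_simps)
    also have "\<dots> \<le> pmf Q x * (1 / (n * pmf Q x) - 1) / ln 2"
      using p n by (intro divide_right_mono mult_left_mono ln_le_minus_one) auto
    also have "\<dots> = (1 / n - pmf Q x) / ln 2" using p n by (simp add: field_simps)
    finally show "- (pmf Q x * log 2 (pmf Q x)) - pmf Q x * log 2 n \<le> (1 / n - pmf Q x) / ln 2" .
  qed
  also have "\<dots> = (card S / n - 1) / ln 2"
    unfolding sum_divide_distrib[symmetric] sum_subtractf sum1 by simp
  also have "\<dots> \<le> 0" using S n by (simp add: divide_nonpos_pos)
  finally show ?thesis by simp
qed

lemma mi_eq_0:
  assumes fin: "finite (set_pmf (map_pmf X P))" "finite (set_pmf (map_pmf Y P))"
    and indep: "map_pmf (\<lambda>w. (X w, Y w)) P = pair_pmf (map_pmf X P) (map_pmf Y P)"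
  shows "mi P X Y = 0"
proof -
  define p where "p = map_pmf X P"
  define q where "q = map_pmf Y P"
  let ?A = "set_pmf p" and ?B = "set_pmf q"
  have A: "(\<Sum>x\<in>?A. pmf p x) = 1" "(\<Sum>y\<in>?B. pmf q y) = 1"
    using fin by (auto intro!: sum_pmf_eq_1 simp: p_def q_def)
  have "(\<Sum>z\<in>?A \<times> ?B. pmf (pair_pmf p q) z * log 2 (pmf (pair_pmf p q) z)) =
      (\<Sum>x\<in>?A. \<Sum>y\<in>?B. pmf p x * pmf q y * log 2 (pmf p x * pmf q y))"
    by (simp add: sum.cartesian_product pmf_pair case_prod_unfold)
      (intro sum.cong, auto simp: pmf_pair)
  also have "\<dots> = (\<Sum>x\<in>?A. \<Sum>y\<in>?B. (pmf p x * log 2 (pmf p x)) * pmf q y + pmf p x * (pmf q y * log 2 (pmf q y)))"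
    by (intro sum.cong refl) (auto simp: log_mult pmf_positive algebra_simps)
  also have "\<dots> = (\<Sum>x\<in>?A. pmf p x * log 2 (pmf p x)) + (\<Sum>y\<in>?B. pmf q y * log 2 (pmf q y))"
    by (simp only: sum.distrib sum_distrib_left[symmetric] sum_distrib_right[symmetric] A mult_1 mult_1_right)
  finally show ?thesis
    unfolding mi_def ent_def indep by (simp add: p_def q_def)
qed

text \<open>Given the files, the law of the view depends on \<open>g\<close> alone, and
  \<open>f\<close> is independent of \<open>g\<close>, so \<open>f\<close> learns nothing from the
  view. For delivery, \<open>g\<close> is constant and \<open>f\<close> is the whole tuple; for
  caching, \<open>g\<close> is the requested file and \<open>f\<close> the others.\<close>

lemma indep_of_kernel:
  assumes fg: "map_pmf (\<lambda>w. (f w, g w)) W = pair_pmf (map_pmf f W) (map_pmf g W)"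
    and ker: "\<And>w w'. w \<in> set_pmf W \<Longrightarrow> w' \<in> set_pmf W \<Longrightarrow> g w = g w' \<Longrightarrow>
      map_pmf (\<lambda>\<rho>. view (w, \<rho>)) q = map_pmf (\<lambda>\<rho>. view (w', \<rho>)) q"
  shows "map_pmf (\<lambda>\<omega>. (f (fst \<omega>), view \<omega>)) (pair_pmf W q) =
    pair_pmf (map_pmf (\<lambda>\<omega>. f (fst \<omega>)) (pair_pmf W q)) (map_pmf view (pair_pmf W q))"
proof -
  \<comment> \<open>One representative per value of \<open>g\<close> turns the conditional law of
    the view into a function of \<open>g w\<close>.\<close>
  define rep where "rep b = (SOME w. w \<in> set_pmf W \<and> g w = b)" for b
  define \<kappa> where "\<kappa> b = map_pmf (\<lambda>\<rho>. view (rep b, \<rho>)) q" for b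
  have \<kappa>: "map_pmf (\<lambda>\<rho>. view (w, \<rho>)) q = \<kappa> (g w)" if "w \<in> set_pmf W" for w
  proof -
    have "rep (g w) \<in> set_pmf W \<and> g (rep (g w)) = g w"
      unfolding rep_def by (rule someI[of _ w]) (use that in simp)
    then show ?thesis unfolding \<kappa>_def using ker[of w "rep (g w)"] that by simp
  qed
  define \<mu> where "\<mu> = bind_pmf (map_pmf g W) \<kappa>"
  have "map_pmf (\<lambda>\<omega>. (f (fst \<omega>), view \<omega>)) (pair_pmf W q) =
      bind_pmf W (\<lambda>w. map_pmf (Pair (f w)) (map_pmf (\<lambda>\<rho>. view (w, \<rho>)) q))"
    by (simp add: pair_pmf_def map_bind_pmf map_pmf_comp map_pmf_def bind_assoc_pmf bind_return_pmf)
  also have "\<dots> = bind_pmf W (\<lambda>w. map_pmf (Pair (f w)) (\<kappa> (g w)))"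
    by (intro bind_pmf_cong refl) (simp add: \<kappa>)
  also have "\<dots> = bind_pmf (map_pmf (\<lambda>w. (f w, g w)) W) (\<lambda>(a, b). map_pmf (Pair a) (\<kappa> b))"
    by (simp add: bind_map_pmf)
  also have "\<dots> = pair_pmf (map_pmf f W) \<mu>"
    unfolding fg \<mu>_def
    by (simp add: pair_pmf_def map_pmf_def bind_assoc_pmf bind_return_pmf)
  finally have *: "map_pmf (\<lambda>\<omega>. (f (fst \<omega>), view \<omega>)) (pair_pmf W q) = pair_pmf (map_pmf f W) \<mu>" .
  have "map_pmf (\<lambda>\<omega>. f (fst \<omega>)) (pair_pmf W q) = map_pmf f W"
    using arg_cong[OF *, of "map_pmf fst"] by (simp add: map_pmf_comp map_fst_pair_pmf)
  moreover have "map_pmf view (pair_pmf W q) = \<mu>"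
    using arg_cong[OF *, of "map_pmf snd"] by (simp add: map_pmf_comp map_snd_pair_pmf)
  ultimately show ?thesis using * by simp
qed

text \<open>The passage from the permutations of \<open>perfect_scheme\<close> to laws: a
  permutation of \<open>Q\<close> preserves the uniform distribution.\<close>

lemma map_pmf_of_set_eqI:
  assumes "finite Q" "Q \<noteq> {}" "bij_betw \<pi> Q Q" "\<And>\<rho>. \<rho> \<in> Q \<Longrightarrow> v (\<pi> \<rho>) = u \<rho>"
  shows "map_pmf u (pmf_of_set Q) = map_pmf v (pmf_of_set Q)"
proof -
  have "map_pmf v (pmf_of_set Q) = map_pmf v (map_pmf \<pi> (pmf_of_set Q))"
    using map_pmf_of_set_bij_betw[OF assms(3,2,1)] by simp
  also have "\<dots> = map_pmf u (pmf_of_set Q)"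
    unfolding map_pmf_comp using assms by (intro map_pmf_cong) auto
  finally show ?thesis by simp
qed

lemma pmf_of_set_Times:
  assumes "finite A" "A \<noteq> {}" "finite B" "B \<noteq> {}"
  shows "pmf_of_set (A \<times> B) = pair_pmf (pmf_of_set A) (pmf_of_set B)"
proof (rule pmf_eqI)
  fix z
  have "A \<times> B \<noteq> {}" using assms by blast
  then show "pmf (pmf_of_set (A \<times> B)) z = pmf (pair_pmf (pmf_of_set A) (pmf_of_set B)) z"
    using assms by (cases z) (simp add: pmf_pair indicator_def card_cartesian_product)
qed

section \<open>The uniform law on file tuples, and binary codes\<close>

lemma finite_bool_lists: "finite {xs :: bool list. length xs = F}"
  using finite_lists_length_eq[of "UNIV :: bool set" F] by simp

lemma card_bool_lists: "card {xs :: bool list. length xs = F} = 2 ^ F"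
  using card_lists_length_eq[of "UNIV :: bool set" F] by simp

lemma finite_file_tuples: "finite (file_tuples D F)"
proof -
  have "file_tuples D F \<subseteq> {w. \<forall>i. (i \<in> {..<D} \<longrightarrow> w i \<in> {xs. length xs = F}) \<and> (i \<notin> {..<D} \<longrightarrow> w i = [])}"
    unfolding file_tuples_def by (intro Collect_mono impI allI) (simp add: not_less)
  then show ?thesis
    by (rule finite_subset) (intro finite_set_of_finite_funs finite_lessThan finite_bool_lists)
qed

lemma file_tuples_nonempty: "file_tuples D F \<noteq> {}"
proof -
  have "(\<lambda>i. if i < D then replicate F True else []) \<in> file_tuples D F"
    by (auto simp: file_tuples_def)
  then show ?thesis by blast
qed

text \<open>Blanking coordinate \<open>k\<close> and recording it separately maps the tuples
  bijectively onto a Cartesian product, so the uniform law becomes a product of uniform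
  laws.\<close>

lemma file_tuples_split:
  assumes "k < D"
  defines "f \<equiv> \<lambda>w :: nat \<Rightarrow> bool list. (\<lambda>i. if i \<noteq> k then w i else [])"
  shows "map_pmf (\<lambda>w. (f w, w k)) (pmf_of_set (file_tuples D F)) =
      pair_pmf (map_pmf f (pmf_of_set (file_tuples D F))) (map_pmf (\<lambda>w. w k) (pmf_of_set (file_tuples D F)))"
    and "map_pmf (\<lambda>w. w k) (pmf_of_set (file_tuples D F)) = pmf_of_set {xs. length xs = F}"
proof -
  let ?FT = "file_tuples D F" and ?L = "{xs :: bool list. length xs = F}"
  have inj: "inj_on (\<lambda>w. (f w, w k)) ?FT"
  proof (rule inj_onI)
    fix w w' assume "(f w, w k) = (f w', w' k)"
    then have eq: "f w = f w'" "w k = w' k" by simp_all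
    show "w = w'"
    proof
      fix i show "w i = w' i" using fun_cong[OF eq(1), of i] eq(2) by (cases "i = k") (auto simp: f_def)
    qed
  qed
  have img: "(\<lambda>w. (f w, w k)) ` ?FT = f ` ?FT \<times> ?L"
  proof (intro equalityI subsetI)
    fix x assume "x \<in> (\<lambda>w. (f w, w k)) ` ?FT"
    then show "x \<in> f ` ?FT \<times> ?L" using assms(1) by (auto simp: file_tuples_def)
  next
    fix x assume "x \<in> f ` ?FT \<times> ?L"
    then obtain w xs where *: "w \<in> ?FT" "length xs = F" "x = (f w, xs)" by auto
    then have "w(k := xs) \<in> ?FT" using assms(1) by (auto simp: file_tuples_def)
    moreover have "x = (f (w(k := xs)), (w(k := xs)) k)" using * by (auto simp: f_def)
    ultimately show "x \<in> (\<lambda>w. (f w, w k)) ` ?FT" by blast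
  qed
  have L: "?L \<noteq> {}" using card_bool_lists[of F] by (metis card.empty power_not_zero zero_neq_numeral)
  have *: "map_pmf (\<lambda>w. (f w, w k)) (pmf_of_set ?FT) = pair_pmf (pmf_of_set (f ` ?FT)) (pmf_of_set ?L)"
    using map_pmf_of_set_inj[OF inj file_tuples_nonempty finite_file_tuples]
      pmf_of_set_Times[OF _ _ finite_bool_lists L, of "f ` ?FT"] finite_file_tuples file_tuples_nonempty
    unfolding img by simp
  show 2: "map_pmf (\<lambda>w. w k) (pmf_of_set ?FT) = pmf_of_set ?L"
    using arg_cong[OF *, of "map_pmf snd"] by (simp add: map_pmf_comp map_snd_pair_pmf)
  have "map_pmf f (pmf_of_set ?FT) = pmf_of_set (f ` ?FT)"
    using arg_cong[OF *, of "map_pmf fst"] by (simp add: map_pmf_comp map_fst_pair_pmf)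
  then show "map_pmf (\<lambda>w. (f w, w k)) (pmf_of_set ?FT) =
      pair_pmf (map_pmf f (pmf_of_set ?FT)) (map_pmf (\<lambda>w. w k) (pmf_of_set ?FT))"
    using * 2 by simp
qed

text \<open>Lists of length at most \<open>\<lfloor>x\<rfloor>\<close> number \<open>2 ^ (\<lfloor>x\<rfloor> + 1) - 1\<close>, so rounding the rate costs nothing.\<close>

lemma bool_list_code:
  assumes "0 \<le> x" "real n \<le> 2 powr x"
  obtains c :: "nat \<Rightarrow> bool list" where "inj_on c {..<n}" "\<And>k. real (length (c k)) \<le> x"
proof -
  define L where "L = nat \<lfloor>x\<rfloor>"
  let ?B = "{xs :: bool list. length xs \<le> L}"
  have L: "real L \<le> x" "x < real L + 1" unfolding L_def using assms(1) by linarith+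
  have fin: "finite ?B" using finite_lists_length_le[of "UNIV :: bool set" L] by simp
  have card: "card ?B = (\<Sum>i\<le>L. 2 ^ i)" using card_lists_length_le[of "UNIV :: bool set" L] by simp
  have sum2: "(\<Sum>i\<le>k. 2 ^ i :: nat) + 1 = 2 ^ (k + 1)" for k by (induction k) auto
  have "real n < 2 powr (real L + 1)" using assms(2) L(2) by (smt (verit) powr_less_mono)
  also have "\<dots> = real (2 ^ (L + 1))" by (simp add: powr_add powr_realpow)
  finally have "n \<le> card ?B" using card sum2[of L] by (simp only: of_nat_less_iff)
  then obtain f where f: "inj_on f {..<n}" "f ` {..<n} \<subseteq> ?B"
    using inj_on_iff_card_le[of "{..<n}" ?B] fin by auto
  show thesis
  proof (rule that[of "\<lambda>k. if k < n then f k else []"])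
    show "inj_on (\<lambda>k. if k < n then f k else []) {..<n}" using f(1) by (auto simp: inj_on_def)
    show "real (length (if k < n then f k else [])) \<le> x" for k
    proof (cases "k < n")
      case True
      then have "length (f k) \<le> L" using f(2) by auto
      then show ?thesis using True L by simp
    qed (use assms in simp)
  qed
qed

section \<open>From alphabets to bits\<close>

text \<open>The symbols are embedded into bit strings by \<open>\<iota>\<close>, and files are
  turned back into symbols by \<open>\<phi>\<close>. Perfect secrecy holds for all fixed tuples,
  hence for \<open>\<phi> \<circ> w\<close>, with mutual information exactly 0. Decoding can fail
  only if the requested file is outside the range of \<open>\<iota>\<close>, which has probability
  \<open>1 - a / 2 ^ F\<close>.\<close>

lemma scheme_ok_of_perfect_sizes:
  assumes ps: "perfect_sizes h r D a nV nZ nX nY"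
    and a: "real a \<le> 2 ^ F" "(1 - \<epsilon>) * 2 ^ F < real a"
    and bounds: "real nV \<le> 2 powr (N * F)" "real nZ \<le> 2 powr (M * F)"
      "real nX \<le> 2 powr (R1 * F)" "real nY \<le> 2 powr (R2 * F)"
    and "0 \<le> R1" "0 \<le> R2" "0 < \<delta>"
  shows "\<exists>q Vc Zc Xs Yf Dec. scheme_ok h r D M N R1 R2 \<epsilon> \<delta> F q Vc Zc Xs Yf Dec"
proof -
  obtain Q :: "nat set" and V :: "nat \<Rightarrow> (nat \<Rightarrow> nat) \<Rightarrow> nat \<Rightarrow> nat"
    and Z :: "nat set \<Rightarrow> (nat \<Rightarrow> nat) \<Rightarrow> nat \<Rightarrow> nat"
    and X :: "nat \<Rightarrow> (nat set \<Rightarrow> nat) \<Rightarrow> (nat \<Rightarrow> nat) \<Rightarrow> nat \<Rightarrow> nat"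
    and Y :: "nat \<Rightarrow> (nat set \<Rightarrow> nat) \<Rightarrow> nat set \<Rightarrow> (nat \<Rightarrow> nat) \<Rightarrow> nat \<Rightarrow> nat"
    where "perfect_scheme h r D {..<a} Q V Z X Y"
      and lt: "\<forall>w\<in>{..<D} \<rightarrow> {..<a}. \<forall>q\<in>Q.
         (\<forall>j<h. V j w q < nV) \<and> (\<forall>S\<in>users h r. Z S w q < nZ) \<and>
         (\<forall>d\<in>demands h r D. (\<forall>i<h. X i d w q < nX) \<and>
            (\<forall>S\<in>users h r. \<forall>i\<in>S. Y i d S w q < nY))"
    using ps unfolding perfect_sizes_def by blast
  interpret perfect_scheme h r D "{..<a}" Q V Z X Y by fact
  \<comment> \<open>The length bounds of \<open>scheme_ok\<close> concern every sample point, also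
    outside the support; the codes satisfy them at every argument.\<close>
  obtain cX :: "nat \<Rightarrow> bool list" where cX: "inj_on cX {..<nX}" "\<And>k. real (length (cX k)) \<le> R1 * F"
    using bool_list_code[OF mult_nonneg_nonneg[OF \<open>0 \<le> R1\<close> of_nat_0_le_iff] bounds(3)] by blast
  obtain cY :: "nat \<Rightarrow> bool list" where cY: "inj_on cY {..<nY}" "\<And>k. real (length (cY k)) \<le> R2 * F"
    using bool_list_code[OF mult_nonneg_nonneg[OF \<open>0 \<le> R2\<close> of_nat_0_le_iff] bounds(4)] by blast
  let ?L = "{xs :: bool list. length xs = F}"
  have "a \<le> card ?L" using a(1) by (simp add: card_bool_lists flip: of_nat_le_iff)
  then obtain \<iota> where \<iota>: "inj_on \<iota> {..<a}" "\<iota> ` {..<a} \<subseteq> ?L"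
    using inj_on_iff_card_le[of "{..<a}" ?L] finite_bool_lists by auto
  have a0: "0 < a" using A_ne by (simp add: lessThan_empty_iff)
  \<comment> \<open>Bit strings outside the range of \<open>\<iota>\<close> get the symbol 0 by
    default, which keeps \<open>\<phi>\<close> total at the price of a decoding error.\<close>
  define \<phi> where "\<phi> xs = (if xs \<in> \<iota> ` {..<a} then inv_into {..<a} \<iota> xs else 0)" for xs
  have \<phi>: "\<phi> xs < a" for xs
    using a0 inv_into_into[of xs \<iota> "{..<a}"] by (auto simp: \<phi>_def)
  have \<phi>w: "\<phi> \<circ> w \<in> {..<D} \<rightarrow> {..<a}" for w :: "nat \<Rightarrow> bool list" using \<phi> by auto
  have \<iota>\<phi>: "\<iota> (\<phi> xs) = xs" if "xs \<in> \<iota> ` {..<a}" for xs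
    using that by (simp add: \<phi>_def f_inv_into_f)

  let ?W = "{..<D} \<rightarrow> {..<a}" and ?FT = "file_tuples D F"
  define P where "P = pair_pmf (pmf_of_set ?FT) (pmf_of_set Q)"
  \<comment> \<open>Caches are limited in entropy, not in length, so an injective unary encoding is
    good enough.\<close>
  define Vc where "Vc j \<omega> = replicate (V j (\<phi> \<circ> fst \<omega>) (snd \<omega>)) True" for j and \<omega> :: "(nat \<Rightarrow> bool list) \<times> nat"
  define Zc where "Zc S \<omega> = replicate (Z S (\<phi> \<circ> fst \<omega>) (snd \<omega>)) True" for S and \<omega> :: "(nat \<Rightarrow> bool list) \<times> nat"
  define Xs where "Xs i d \<omega> = cX (X i d (\<phi> \<circ> fst \<omega>) (snd \<omega>))" for i d and \<omega> :: "(nat \<Rightarrow> bool list) \<times> nat"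
  \<comment> \<open>The relay picks any file tuple and randomness consistent with what it sees;
    \<open>relay_function\<close> makes the outcome unique. The decoder relies on
    \<open>decodable\<close> in the same way.\<close>
  define Yf where "Yf i d S x v = cY (SOME y. \<exists>w\<in>?W. \<exists>q\<in>Q.
      x = cX (X i d w q) \<and> v = replicate (V i w q) True \<and> y = Y i d S w q)" for i d S x v
  define Dec where "Dec S d z ys = \<iota> (SOME k. \<exists>w\<in>?W. \<exists>q\<in>Q.
      z = replicate (Z S w q) True \<and> (\<forall>j\<in>S. ys j = cY (Y j d S w q)) \<and> k = w (d S))"
    for S d z and ys :: "nat \<Rightarrow> bool list"
  define Yv where "Yv i d S \<omega> = Yf i d S (Xs i d \<omega>) (Vc i \<omega>)" for i d S \<omega>
  define Rcv where "Rcv d S \<omega> = (\<lambda>j. if j \<in> S then Yv j d S \<omega> else [])" for d S \<omega>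

  have setP: "set_pmf P = ?FT \<times> Q"
    unfolding P_def using finite_file_tuples file_tuples_nonempty finite_Q Q_ne by simp
  have finP: "finite (set_pmf (map_pmf f P))" for f :: "(nat \<Rightarrow> bool list) \<times> nat \<Rightarrow> 'c"
    using setP finite_file_tuples finite_Q by simp
  have Yv: "Yv i d S (w, q) = cY (Y i d S (\<phi> \<circ> w) q)"
    if "d \<in> demands h r D" "S \<in> users h r" "i \<in> S" "q \<in> Q" for i d S w q
  proof -
    have i: "i < h" using users_subset that by blast
    let ?A = "\<lambda>y. \<exists>w'\<in>?W. \<exists>q'\<in>Q. Xs i d (w, q) = cX (X i d w' q') \<and>
      Vc i (w, q) = replicate (V i w' q') True \<and> y = Y i d S w' q'"
    have "(SOME y. ?A y) = Y i d S (\<phi> \<circ> w) q"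
    proof (rule some_equality)
      show "?A (Y i d S (\<phi> \<circ> w) q)"
        using \<phi>w that(4) by (intro bexI[of _ "\<phi> \<circ> w"] bexI[of _ q]) (simp_all add: Xs_def Vc_def)
    next
      fix y assume "?A y"
      then obtain w' q' where *: "w' \<in> ?W" "q' \<in> Q" "cX (X i d (\<phi> \<circ> w) q) = cX (X i d w' q')"
        "replicate (V i (\<phi> \<circ> w) q) True = replicate (V i w' q') True" "y = Y i d S w' q'"
        by (auto simp: Xs_def Vc_def)
      have "X i d (\<phi> \<circ> w) q = X i d w' q'"
        using inj_onD[OF cX(1) *(3)] lt[rule_format, OF \<phi>w that(4)] lt[rule_format, OF *(1,2)] that i by simp
      moreover have "V i (\<phi> \<circ> w) q = V i w' q'" using arg_cong[OF *(4), of length] by simp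
      ultimately show "y = Y i d S (\<phi> \<circ> w) q"
        using relay_function[OF that(1-3) \<phi>w *(1) that(4) *(2)] *(5) by metis
    qed
    then show ?thesis unfolding Yv_def Yf_def by simp
  qed
  have Dec: "Dec S d (Zc S (w, q)) (Rcv d S (w, q)) = \<iota> (\<phi> (w (d S)))"
    if "d \<in> demands h r D" "S \<in> users h r" "q \<in> Q" for d S w q
  proof -
    let ?A = "\<lambda>k. \<exists>w'\<in>?W. \<exists>q'\<in>Q. Zc S (w, q) = replicate (Z S w' q') True \<and>
      (\<forall>j\<in>S. Rcv d S (w, q) j = cY (Y j d S w' q')) \<and> k = w' (d S)"
    have R: "Rcv d S (w, q) j = cY (Y j d S (\<phi> \<circ> w) q)" if "j \<in> S" for j
      using that Yv[OF \<open>d \<in> _\<close> \<open>S \<in> _\<close> _ \<open>q \<in> _\<close>] by (simp add: Rcv_def)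
    have "(SOME k. ?A k) = \<phi> (w (d S))"
    proof (rule some_equality)
      show "?A (\<phi> (w (d S)))"
        using \<phi>w that(3) R by (intro bexI[of _ "\<phi> \<circ> w"] bexI[of _ q]) (simp_all add: Zc_def)
    next
      fix k assume "?A k"
      then obtain w' q' where *: "w' \<in> ?W" "q' \<in> Q" "replicate (Z S (\<phi> \<circ> w) q) True = replicate (Z S w' q') True"
        "\<forall>j\<in>S. Rcv d S (w, q) j = cY (Y j d S w' q')" "k = w' (d S)"
        by (auto simp: Zc_def)
      have "Z S (\<phi> \<circ> w) q = Z S w' q'" using arg_cong[OF *(3), of length] by simp
      moreover have "\<forall>j\<in>S. Y j d S (\<phi> \<circ> w) q = Y j d S w' q'"
      proof
        fix j assume j: "j \<in> S"
        then have "cY (Y j d S (\<phi> \<circ> w) q) = cY (Y j d S w' q')" using R *(4) by simp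
        then show "Y j d S (\<phi> \<circ> w) q = Y j d S w' q'"
          using inj_onD[OF cY(1)] lt[rule_format, OF \<phi>w that(3)] lt[rule_format, OF *(1,2)] that j by simp
      qed
      ultimately have "(\<phi> \<circ> w) (d S) = w' (d S)"
        using decodable[OF that(1,2) \<phi>w *(1) that(3) *(2)] by blast
      then show "k = \<phi> (w (d S))" using *(5) by simp
    qed
    then show ?thesis unfolding Dec_def by simp
  qed
  have ent_bound: "ent P (\<lambda>\<omega>. replicate (f \<omega>) True) \<le> c * F"
    if "\<And>w q. q \<in> Q \<Longrightarrow> f (w, q) < k" "real k \<le> 2 powr (c * F)"
    for f :: "(nat \<Rightarrow> bool list) \<times> nat \<Rightarrow> nat" and k and c :: real
  proof -
    have "0 < k" using that(1) Q_ne by (metis all_not_in_conv gr_zeroI not_less_zero)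
    have "set_pmf (map_pmf (\<lambda>\<omega>. replicate (f \<omega>) True) P) \<subseteq> (\<lambda>n. replicate n True) ` {..<k}"
      using that(1) setP by auto
    then have "ent P (\<lambda>\<omega>. replicate (f \<omega>) True) \<le> log 2 k"
      by (rule ent_le_log_card[rotated]) (auto intro: card_image_le[of "{..<k}", simplified])
    also have "\<dots> \<le> log 2 (2 powr (c * F))" using that(2) \<open>0 < k\<close> by (subst log_le_cancel_iff) auto
    also have "\<dots> = c * F" by simp
    finally show ?thesis .
  qed
  have entV: "ent P (Vc j) \<le> N * real F" if "j < h" for j
    unfolding Vc_def using lt[rule_format, OF \<phi>w] that by (intro ent_bound[OF _ bounds(1)]) simp
  have entZ: "ent P (Zc S) \<le> M * real F" if "S \<in> users h r" for S
    unfolding Zc_def using lt[rule_format, OF \<phi>w] that by (intro ent_bound[OF _ bounds(2)]) simp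
  have dem: "d S < D" if "d \<in> demands h r D" "S \<in> users h r" for d S
    using that by (auto simp: demands_def)
  have err: "measure_pmf.prob P {\<omega>. Dec S d (Zc S \<omega>) (Rcv d S \<omega>) \<noteq> fst \<omega> (d S)} < \<epsilon>"
    if "d \<in> demands h r D" "S \<in> users h r" for d S
  proof -
    have "measure_pmf.prob P {\<omega>. Dec S d (Zc S \<omega>) (Rcv d S \<omega>) \<noteq> fst \<omega> (d S)}
        \<le> measure_pmf.prob P ((\<lambda>\<omega>. fst \<omega> (d S)) -` (- \<iota> ` {..<a}))"
    proof (rule measure_pmf.finite_measure_mono_AE)
      show "AE \<omega> in measure_pmf P. \<omega> \<in> {\<omega>. Dec S d (Zc S \<omega>) (Rcv d S \<omega>) \<noteq> fst \<omega> (d S)} \<longrightarrow>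
          \<omega> \<in> (\<lambda>\<omega>. fst \<omega> (d S)) -` (- \<iota> ` {..<a})"
        unfolding AE_measure_pmf_iff setP using Dec[OF that] \<iota>\<phi> by auto
    qed simp
    also have "\<dots> = measure_pmf.prob (map_pmf (\<lambda>\<omega>. fst \<omega> (d S)) P) (- \<iota> ` {..<a})"
      by simp
    also have "map_pmf (\<lambda>\<omega>. fst \<omega> (d S)) P = pmf_of_set ?L"
      using file_tuples_split(2)[OF dem[OF that], of F]
      by (simp add: P_def map_pmf_comp[symmetric, of "\<lambda>w. w (d S)" fst] map_fst_pair_pmf)
    also have "measure_pmf.prob (pmf_of_set ?L) (- \<iota> ` {..<a}) = real (card (?L - \<iota> ` {..<a})) / 2 ^ F"
    proof -
      have "?L \<noteq> {}" using card_bool_lists[of F] by (metis card.empty power_not_zero zero_neq_numeral)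
      then show ?thesis
        using measure_pmf_of_set[OF _ finite_bool_lists, of F] by (simp add: card_bool_lists Diff_eq)
    qed
    also have "card (?L - \<iota> ` {..<a}) = 2 ^ F - a"
      using \<iota> by (simp add: card_Diff_subset card_image card_bool_lists)
    also have "real (2 ^ F - a) / 2 ^ F < \<epsilon>"
    proof -
      have "a \<le> 2 ^ F" using a(1) by (simp flip: of_nat_le_iff)
      then have "real (2 ^ F - a) = 2 ^ F - real a" by (simp add: of_nat_diff)
      then show ?thesis using a(2) by (simp add: field_simps)
    qed
    finally show ?thesis .
  qed
  have fstP: "map_pmf (\<lambda>\<omega>. f (fst \<omega>)) P = map_pmf f (pmf_of_set ?FT)" for f :: "(nat \<Rightarrow> bool list) \<Rightarrow> 'c"
    by (simp add: P_def map_pmf_comp[symmetric, of f fst] map_fst_pair_pmf)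
  have delivery: "mi P (\<lambda>\<omega>. ((\<lambda>i. if i < h then Xs i d \<omega> else []),
        (\<lambda>(i, S). if i < h \<and> S \<in> users h r \<and> i \<in> S then Yv i d S \<omega> else []))) fst < \<delta>"
    (is "mi P ?view fst < \<delta>") if d: "d \<in> demands h r D" for d
  proof -
    have "map_pmf (\<lambda>\<omega>. (fst \<omega>, ?view \<omega>)) P = pair_pmf (map_pmf fst P) (map_pmf ?view P)"
      unfolding P_def
    proof (rule indep_of_kernel[where f = "\<lambda>w. w" and g = "\<lambda>_. ()"])
      show "map_pmf (\<lambda>w. (w, ())) (pmf_of_set ?FT) =
          pair_pmf (map_pmf (\<lambda>w. w) (pmf_of_set ?FT)) (map_pmf (\<lambda>_. ()) (pmf_of_set ?FT))"
        by (simp add: map_pmf_const pair_return_pmf2)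
      fix w w' :: "nat \<Rightarrow> bool list"
      obtain \<pi> where \<pi>: "bij_betw \<pi> Q Q" "\<forall>q\<in>Q. (\<forall>i<h. X i d (\<phi> \<circ> w') (\<pi> q) = X i d (\<phi> \<circ> w) q) \<and>
        (\<forall>S\<in>users h r. \<forall>i\<in>S. Y i d S (\<phi> \<circ> w') (\<pi> q) = Y i d S (\<phi> \<circ> w) q)"
        using secure_delivery[OF d \<phi>w \<phi>w] by blast
      show "map_pmf (\<lambda>q. ?view (w, q)) (pmf_of_set Q) = map_pmf (\<lambda>q. ?view (w', q)) (pmf_of_set Q)"
      proof (rule map_pmf_of_set_eqI[OF finite_Q Q_ne \<pi>(1)])
        fix q assume q: "q \<in> Q"
        then have "\<pi> q \<in> Q" using \<pi>(1) bij_betwE by blast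
        then show "?view (w', \<pi> q) = ?view (w, q)"
          using \<pi>(2) q Yv[OF d] by (auto simp: Xs_def fun_eq_iff)
      qed
    qed
    \<comment> \<open>The files come first in \<open>indep_of_kernel\<close> but second in the
      delivery condition.\<close>
    then have "map_pmf (\<lambda>(x, y). (y, x)) (map_pmf (\<lambda>\<omega>. (fst \<omega>, ?view \<omega>)) P) =
        pair_pmf (map_pmf ?view P) (map_pmf fst P)"
      using pair_commute_pmf[of "map_pmf ?view P" "map_pmf fst P"] by simp
    then have "map_pmf (\<lambda>\<omega>. (?view \<omega>, fst \<omega>)) P = pair_pmf (map_pmf ?view P) (map_pmf fst P)"
      unfolding map_pmf_comp by simp
    then have "mi P ?view fst = 0" by (intro mi_eq_0 finP)
    then show ?thesis using \<open>0 < \<delta>\<close> by simp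
  qed
  have caching: "mi P (\<lambda>\<omega>. (\<lambda>i. if i \<noteq> d S then fst \<omega> i else [])) (\<lambda>\<omega>. (Rcv d S \<omega>, Zc S \<omega>)) < \<delta>"
    (is "mi P ?f ?view < \<delta>") if d: "d \<in> demands h r D" and S: "S \<in> users h r" for d S
  proof -
    have "map_pmf (\<lambda>\<omega>. (?f \<omega>, ?view \<omega>)) P = pair_pmf (map_pmf ?f P) (map_pmf ?view P)"
      unfolding P_def
    proof (rule indep_of_kernel[where f = "\<lambda>w i. if i \<noteq> d S then w i else []" and g = "\<lambda>w. w (d S)",
          OF file_tuples_split(1)[OF dem[OF d S]]])
      fix w w' :: "nat \<Rightarrow> bool list" assume "w (d S) = w' (d S)"
      then obtain \<pi> where \<pi>: "bij_betw \<pi> Q Q" "\<forall>q\<in>Q. Z S (\<phi> \<circ> w') (\<pi> q) = Z S (\<phi> \<circ> w) q \<and>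
        (\<forall>j\<in>S. Y j d S (\<phi> \<circ> w') (\<pi> q) = Y j d S (\<phi> \<circ> w) q)"
        using secure_caching[OF d S \<phi>w \<phi>w, of w w'] by auto
      show "map_pmf (\<lambda>q. ?view (w, q)) (pmf_of_set Q) = map_pmf (\<lambda>q. ?view (w', q)) (pmf_of_set Q)"
      proof (rule map_pmf_of_set_eqI[OF finite_Q Q_ne \<pi>(1)])
        fix q assume q: "q \<in> Q"
        then have "\<pi> q \<in> Q" using \<pi>(1) bij_betwE by blast
        then show "?view (w', \<pi> q) = ?view (w, q)"
          using \<pi>(2) q Yv[OF d S] by (auto simp: Rcv_def Zc_def fun_eq_iff)
      qed
    qed
    then have "mi P ?f ?view = 0" by (intro mi_eq_0 finP)
    then show ?thesis using \<open>0 < \<delta>\<close> by simp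
  qed
  have "scheme_ok h r D M N R1 R2 \<epsilon> \<delta> F (pmf_of_set Q) Vc Zc Xs Yf Dec"
    unfolding scheme_ok_def Let_def P_def[symmetric] Yv_def[symmetric] Rcv_def[symmetric]
  proof (intro conjI ballI allI impI)
    show "finite (set_pmf (pmf_of_set Q))" using finite_Q Q_ne by simp
    show "real (length (Xs i d \<omega>)) \<le> R1 * real F" for i d \<omega> unfolding Xs_def by (rule cX)
    show "real (length (Yv i d S \<omega>)) \<le> R2 * real F" for i d S \<omega> unfolding Yv_def Yf_def by (rule cY)
  qed (use entV entZ err delivery caching in auto)
  then show ?thesis by blast
qed

section \<open>Rates\<close>

text \<open>The largest \<open>m \<le> 2 powr y\<close> with \<open>m \<equiv> 1 (mod B)\<close>: for a suitable factorial \<open>B\<close> all small differences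
  of evaluation points are units modulo \<open>m\<close>.\<close>

definition near_pow :: "nat \<Rightarrow> real \<Rightarrow> nat" where
  "near_pow B y = 1 + B * nat \<lfloor>(2 powr y - 1) / real B\<rfloor>"

lemma coprime_near_pow: "k dvd B \<Longrightarrow> coprime k (near_pow B y)"
  unfolding near_pow_def by (rule coprimeI) (metis dvd_add_left_iff dvd_mult2 dvd_trans)

lemma near_pow_le:
  assumes "0 \<le> y" "0 < B"
  shows "real (near_pow B y) \<le> 2 powr y"
proof -
  have "(1 :: real) \<le> 2 powr y" using assms by (simp add: ge_one_powr_ge_zero)
  then have "real (nat \<lfloor>(2 powr y - 1) / real B\<rfloor>) \<le> (2 powr y - 1) / real B"
    using assms by (intro of_nat_floor) simp
  then show ?thesis using assms(2) by (simp add: near_pow_def field_simps)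
qed

lemma near_pow_ge:
  assumes "0 < B"
  shows "2 powr y - real B \<le> real (near_pow B y)"
proof -
  have "(2 powr y - 1) / real B < real (nat \<lfloor>(2 powr y - 1) / real B\<rfloor>) + 1" by linarith
  then have "2 powr y - 1 < (real (nat \<lfloor>(2 powr y - 1) / real B\<rfloor>) + 1) * real B"
    using assms by (simp add: divide_less_eq)
  then show ?thesis unfolding near_pow_def by (simp add: algebra_simps)
qed

text \<open>The loss is at most the constant \<open>B\<close>, so the relative loss decays like
  \<open>2 powr (- c F)\<close> if \<open>c > 0\<close>. The case \<open>c = 0\<close>, where both
  quantities are 1, arises from zero weights and from \<open>\<alpha>\<close> equal to 0 or
  1.\<close>

lemma near_pow_ratio_tendsto:
  assumes "0 \<le> c" "0 < B"
  shows "(\<lambda>F. real (near_pow B (c * real F)) / 2 powr (c * real F)) \<longlonglongrightarrow> 1"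
proof (cases "c = 0")
  case True
  then show ?thesis by (simp add: near_pow_def)
next
  case False
  then have c: "0 < c" using assms by simp
  have "(\<lambda>F. (2 powr (- c)) ^ F) \<longlonglongrightarrow> 0"
    using c by (intro LIMSEQ_power_zero) (simp add: powr_less_one)
  then have "(\<lambda>F. 2 powr (- (c * real F))) \<longlonglongrightarrow> 0"
    by (simp add: powr_powr flip: powr_realpow)
  then have "(\<lambda>F. 1 - real B * 2 powr (- (c * real F))) \<longlonglongrightarrow> 1 - real B * 0"
    by (intro tendsto_intros)
  then have lim: "(\<lambda>F. 1 - real B * 2 powr (- (c * real F))) \<longlonglongrightarrow> 1" by simp
  show ?thesis
  proof (rule tendsto_sandwich[OF _ _ lim tendsto_const])
    show "\<forall>\<^sub>F F in sequentially. 1 - real B * 2 powr (- (c * real F))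
        \<le> real (near_pow B (c * real F)) / 2 powr (c * real F)"
    proof (rule always_eventually, rule allI)
      fix F
      show "1 - real B * 2 powr (- (c * real F)) \<le> real (near_pow B (c * real F)) / 2 powr (c * real F)"
      proof -
        have "1 - real B / y \<le> k / y" if "y - real B \<le> k" "0 < y" for y k :: real
          using divide_right_mono[OF that(1), of y] that(2) by (simp add: diff_divide_distrib)
        from this[OF near_pow_ge[OF assms(2)], of "c * real F"] show ?thesis
          by (simp add: powr_minus_divide)
      qed
    qed
    show "\<forall>\<^sub>F F in sequentially. real (near_pow B (c * real F)) / 2 powr (c * real F) \<le> 1"
      using near_pow_le[OF _ assms(2)] assms(1) by (intro always_eventually) simp
  qed
qed

lemma powr_power_eq: "(2 powr y) ^ e = 2 powr (y * real e)" for y :: real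
  by (simp add: powr_powr flip: powr_realpow)

lemma prod_near_pow_le:
  assumes "finite I" "0 < B" "\<And>x. x \<in> I \<Longrightarrow> 0 \<le> c x"
  shows "real (\<Prod>x\<in>I. near_pow B (c x * real F) ^ e x) \<le> 2 powr ((\<Sum>x\<in>I. c x * real (e x)) * real F)"
proof -
  have "real (\<Prod>x\<in>I. near_pow B (c x * real F) ^ e x) = (\<Prod>x\<in>I. real (near_pow B (c x * real F)) ^ e x)"
    by simp
  also have "\<dots> \<le> (\<Prod>x\<in>I. (2 powr (c x * real F)) ^ e x)"
    using assms by (intro prod_mono conjI power_mono near_pow_le) auto
  also have "\<dots> = 2 powr (\<Sum>x\<in>I. c x * real F * real (e x))"
    using assms(1) by (simp add: powr_power_eq powr_sum)
  also have "(\<Sum>x\<in>I. c x * real F * real (e x)) = (\<Sum>x\<in>I. c x * real (e x)) * real F"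
    by (simp add: sum_distrib_left mult_ac)
  finally show ?thesis .
qed

text \<open>The rate of the scheme is \<open>\<alpha> K / (r (t + 1))\<close>, where \<open>\<alpha> = 1 - r N / (D + K)\<close> is the fraction of each
  file that the relays do not cache. For \<open>N > 0\<close> it is smaller than \<open>R1_sc\<close>, in which the term \<open>r N D\<close>
  occurs with a positive sign.\<close>

lemma R1_sc_ge:
  assumes "0 < r" "t < Khat h r" "0 < D" "0 \<le> N" "N \<le> (real D + real (Khat h r)) / real r"
  defines "\<alpha> \<equiv> 1 - real r * N / (real D + real (Khat h r))"
  shows "\<alpha> * real (Khat h r) / (real r * (real t + 1)) \<le> R1_sc h r D N (M_sc h r D N t)"
proof -
  define K where "K = real (Khat h r)"
  define u where "u = M_sc h r D N t - 1"
  \<comment> \<open>As \<open>r N = (D + K) (1 - \<alpha>)\<close>, a factor \<open>D + K\<close>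
    cancels from numerator and denominator; what remains of \<open>D\<close> and
    \<open>r N D\<close> together is \<open>D + (1 - \<alpha>) D\<close>.\<close>
  define x where "x = (2 - \<alpha>) * real D"
  have K: "real t < K" "0 < K" using assms by (auto simp: K_def)
  have DK: "0 < real D + K" using K by simp
  have \<alpha>: "0 \<le> \<alpha>" "\<alpha> \<le> 1"
    using assms(1,4,5) DK by (auto simp: \<alpha>_def K_def[symmetric] field_simps)
  have u: "u = real t * real D * \<alpha> / (K - real t)"
    by (simp add: u_def M_sc_def \<alpha>_def K_def)
  have u0: "0 \<le> u" using u \<alpha> K by simp
  have rN: "real r * N * real D = (real D + K) * ((1 - \<alpha>) * real D)"
    using DK by (simp add: \<alpha>_def K_def[symmetric])
  have x0: "0 < x" using \<alpha> assms(3) by (simp add: x_def)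
  have num: "real r * N * real D + (real D + K) * (M_sc h r D N t + real D - 1) = (real D + K) * (x + u)"
    unfolding rN u_def x_def by (simp add: algebra_simps)
  have den: "real r * N * real D + (real D + K) * (real D + (M_sc h r D N t - 1) * (K + 1)) = (real D + K) * (x + u * (K + 1))"
    unfolding rN u_def[symmetric] x_def by (simp add: algebra_simps)
  have "R1_sc h r D N (M_sc h r D N t) =
      K * ((real D + K) * (x + u)) / (real r * ((real D + K) * (x + u * (K + 1)))) * \<alpha>"
    unfolding R1_sc_def Let_def K_def[symmetric] num den by (simp add: \<alpha>_def K_def mult.commute)
  also have "\<dots> = \<alpha> * K / real r * ((x + u) / (x + u * (K + 1)))"
  proof -
    have "K * (y * v) / (real r * (y * z)) * \<alpha> = \<alpha> * K / real r * (v / z)" if "y \<noteq> 0" for y v z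
      using that by (simp add: field_simps)
    from this[of "real D + K"] show ?thesis using DK by auto
  qed
  finally have R1: "R1_sc h r D N (M_sc h r D N t) = \<alpha> * K / real r * ((x + u) / (x + u * (K + 1)))" .
  \<comment> \<open>The whole comparison of the rates rests on
    \<open>\<alpha> \<le> 2 - \<alpha>\<close>, with equality for \<open>N = 0\<close>.\<close>
  have "u * (K - real t) = real t * (\<alpha> * real D)" using u K by simp
  also have "\<dots> \<le> real t * x"
    unfolding x_def using \<alpha> by (intro mult_left_mono mult_right_mono) auto
  finally have "x + u * (K + 1) \<le> (x + u) * (real t + 1)" by (simp add: algebra_simps)
  moreover have "0 < x + u * (K + 1)" using x0 u0 K by (simp add: add_pos_nonneg)
  ultimately have "1 / (real t + 1) \<le> (x + u) / (x + u * (K + 1))"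
    by (simp add: field_simps)
  then have "\<alpha> * K / real r * (1 / (real t + 1)) \<le> \<alpha> * K / real r * ((x + u) / (x + u * (K + 1)))"
    using \<alpha> K assms(1) by (intro mult_left_mono) auto
  then show ?thesis unfolding R1 by (simp add: K_def)
qed

text \<open>The relay-cached part is the same for every \<open>t\<close>, so all points share it;
  point \<open>x\<close> receives the fraction \<open>lam x * \<alpha>\<close> of each file from the
  server part. The index set is abstract because a convex hull supplies weights on points, not on
  values of \<open>t\<close>.\<close>

lemma achievable_time_sharing:
  fixes I :: "'i set" and lam :: "'i \<Rightarrow> real" and tt :: "'i \<Rightarrow> nat"
  assumes r: "0 < r" and D: "0 < D" and N: "0 \<le> N" "N \<le> (real D + real (Khat h r)) / real r"
    and I: "finite I" "\<And>x. x \<in> I \<Longrightarrow> tt x < Khat h r" "\<And>x. x \<in> I \<Longrightarrow> 0 \<le> lam x" "sum lam I = 1"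
  shows "achievable_sc h r D (\<Sum>x\<in>I. lam x * M_sc h r D N (tt x)) N
    (\<Sum>x\<in>I. lam x * R1_sc h r D N (M_sc h r D N (tt x))) (1 / real r)"
  unfolding achievable_sc_def
proof (intro allI impI)
  fix \<epsilon> \<delta> :: real assume "0 < \<epsilon>" "0 < \<delta>"
  define K where "K = Khat h r"
  define \<alpha> where "\<alpha> = 1 - real r * N / (real D + real K)"
  define C where "C x = (K - 1) choose (tt x)" for x
  define n where "n x = K choose (tt x)" for x
  \<comment> \<open>Bits of one symbol per bit of a file: the fraction
    \<open>lam x * \<alpha>\<close> is cut into \<open>r * C x\<close> symbols, and the relay-cached
    fraction \<open>1 - \<alpha>\<close> into \<open>r\<close> symbols.\<close>
  define c where "c x = lam x * \<alpha> / (real r * real (C x))" for x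
  define c0 where "c0 = (1 - \<alpha>) / real r"
  \<comment> \<open>Binomials of \<open>K\<close> and \<open>K - 1\<close> are at most
    \<open>2 ^ K\<close>, so this factorial is divisible by all differences of evaluation points, in
    every component at once.\<close>
  define B where "B = (fact (h + 2 ^ K + 2 ^ K) :: nat)"
  have B: "0 < B" by (simp add: B_def)
  have DK: "0 < real D + real K" using D by simp
  have \<alpha>: "0 \<le> \<alpha>" "\<alpha> \<le> 1"
    using r N DK by (auto simp: \<alpha>_def K_def[symmetric] field_simps)
  have t: "tt x < K" if "x \<in> I" for x using I(2) that by (simp add: K_def)
  have C0: "0 < C x" if "x \<in> I" for x using t[OF that] by (simp add: C_def zero_less_binomial_iff)
  have c: "0 \<le> c x" if "x \<in> I" for x using I(3)[OF that] \<alpha> by (simp add: c_def)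
  have c0: "0 \<le> c0" using \<alpha> by (simp add: c0_def)
  have cC: "c x * real (C x) = lam x * \<alpha> / real r" if "x \<in> I" for x
    using C0[OF that] r by (simp add: c_def field_simps)
  define m where "m x F = near_pow B (c x * real F)" for x F
  define m0 where "m0 F = near_pow B (c0 * real F)" for F :: nat
  have m_pos: "0 < m x F" "0 < m0 F" for x F by (simp_all add: m_def m0_def near_pow_def)
  have cop: "coprime k (m x F)" "coprime k (m0 F)" if "0 < k" "k < h + 2 ^ K + 2 ^ K" for k x F
    unfolding m_def m0_def B_def using that by (auto intro!: coprime_near_pow dvd_fact)
  define a where "a F = (\<Prod>x\<in>I. (m x F ^ C x) ^ r) * m0 F ^ r" for F
  define nV where "nV F = (\<Prod>x\<in>I. 1) * m0 F ^ (D + K)" for F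
  define nZ where "nZ F = (\<Prod>x\<in>I. m x F ^ (r * (D * (n x - C x) + C x))) * m0 F ^ r" for F
  define nX where "nX F = (\<Prod>x\<in>I. m x F ^ (K choose Suc (tt x))) * 1" for F
  define nY where "nY F = (\<Prod>x\<in>I. m x F ^ C x) * m0 F" for F
  have sizes: "perfect_sizes h r D (a F) (nV F) (nZ F) (nX F) (nY F)" for F
    unfolding a_def nV_def nZ_def nX_def nY_def
  proof (intro perfect_sizes_mult perfect_sizes_prod)
    show "finite I" by fact
    show "perfect_sizes h r D (m0 F ^ r) (m0 F ^ (D + K)) (m0 F ^ r) 1 (m0 F)"
      unfolding K_def using r m_pos cop(2) by (intro relay_cached_scheme) auto
    fix x assume x: "x \<in> I"
    have "K choose tt x \<le> 2 ^ K" "(K - 1) choose tt x \<le> 2 ^ K"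
      using binomial_le_pow2[of K] binomial_le_pow2[of "K - 1" "tt x"]
        power_increasing[of "K - 1" K "2 :: nat"] by (auto intro: order_trans)
    then show "perfect_sizes h r D ((m x F ^ C x) ^ r) 1 (m x F ^ (r * (D * (n x - C x) + C x)))
        (m x F ^ (K choose Suc (tt x))) (m x F ^ C x)"
      unfolding C_def n_def K_def
      using r t[OF x] m_pos cop(1) by (intro coded_multicast_scheme) (auto simp: K_def)
  qed
  have m0_bound: "real (m0 F ^ e) \<le> 2 powr (c0 * real e * real F)" for F e
  proof -
    have "real (m0 F ^ e) \<le> (2 powr (c0 * real F)) ^ e"
      unfolding m0_def of_nat_power using c0 B by (intro power_mono near_pow_le) auto
    then show ?thesis by (simp add: powr_power_eq mult_ac)
  qed
  have bound: "real ((\<Prod>x\<in>I. m x F ^ e x) * m0 F ^ e0) \<le> 2 powr (s * real F)"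
    if "(\<Sum>x\<in>I. c x * real (e x)) + c0 * real e0 = s" for e e0 s F
  proof -
    have "real ((\<Prod>x\<in>I. m x F ^ e x) * m0 F ^ e0) = real (\<Prod>x\<in>I. m x F ^ e x) * real (m0 F ^ e0)"
      by (rule of_nat_mult)
    also have "\<dots> \<le> 2 powr ((\<Sum>x\<in>I. c x * real (e x)) * real F) * 2 powr (c0 * real e0 * real F)"
      unfolding m_def by (intro mult_mono m0_bound prod_near_pow_le I(1) B c) auto
    also have "\<dots> = 2 powr (s * real F)"
      unfolding that[symmetric] by (simp add: powr_add[symmetric] distrib_right)
    finally show ?thesis .
  qed
  have sum_lam: "(\<Sum>x\<in>I. lam x * y) = y" for y using I(4) by (simp flip: sum_distrib_right)
  have total: "(\<Sum>x\<in>I. c x * real (C x * r)) + c0 * real r = 1"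
  proof -
    have "(\<Sum>x\<in>I. c x * real (C x * r)) = (\<Sum>x\<in>I. lam x * \<alpha>)"
      using cC r by (intro sum.cong refl) (simp flip: mult.assoc)
    then show ?thesis using sum_lam r by (simp add: c0_def)
  qed
  have a_le: "real (a F) \<le> 2 ^ F" for F
    using bound[OF total, of F] by (simp add: a_def powr_realpow flip: power_mult)
  have nV_le: "real (nV F) \<le> 2 powr (N * F)" for F
  proof -
    \<comment> \<open>The equation behind the choice of \<open>\<alpha>\<close>:
      \<open>D + K\<close> symbols fill the relay cache exactly.\<close>
    have "c0 * real (D + K) = N" using r DK by (simp add: c0_def \<alpha>_def)
    then show ?thesis using m0_bound[of F "D + K"] by (simp add: nV_def)
  qed
  have nZ_le: "real (nZ F) \<le> 2 powr ((\<Sum>x\<in>I. lam x * M_sc h r D N (tt x)) * F)" for F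
    unfolding nZ_def
  proof (rule bound)
    \<comment> \<open>By \<open>(K - t) n = K C\<close>, a user caches
      \<open>n - C = C t / (K - t)\<close> shares per relay and file. The \<open>C\<close> pads
      contribute \<open>\<alpha>\<close>, and the keys of the relay-cached part supply the missing
      \<open>1 - \<alpha>\<close>.\<close>
    have "c x * real (r * (D * (n x - C x) + C x)) = lam x * (M_sc h r D N (tt x) - (1 - \<alpha>))"
      if x: "x \<in> I" for x
    proof -
      have Kt: "0 < real K - real (tt x)" using t[OF x] by simp
      have "C x \<le> n x" unfolding C_def n_def by (rule binomial_right_mono) simp
      moreover have "(K - tt x) * n x = K * C x"
        unfolding n_def C_def by (rule binomial_absorb_comp)
      then have "real ((K - tt x) * n x) = real (K * C x)" by (rule arg_cong)
      then have "(real K - real (tt x)) * real (n x) = real K * real (C x)"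
        using t[OF x] by (simp add: of_nat_diff)
      then have "real (n x) = real K * real (C x) / (real K - real (tt x))"
        using Kt by (simp add: field_simps)
      ultimately have "real (n x - C x) = real (C x) * (real (tt x) / (real K - real (tt x)))"
        using Kt by (simp add: of_nat_diff field_simps)
      then have "c x * real (r * (D * (n x - C x) + C x)) =
          c x * real (C x) * (real r * (real D * (real (tt x) / (real K - real (tt x))) + 1))"
        unfolding of_nat_mult of_nat_add by (simp add: algebra_simps)
      also have "\<dots> = lam x * (\<alpha> * (real D * (real (tt x) / (real K - real (tt x))) + 1))"
        unfolding cC[OF x] using r by simp
      also have "\<alpha> * (real D * (real (tt x) / (real K - real (tt x))) + 1) = M_sc h r D N (tt x) - (1 - \<alpha>)"
        unfolding M_sc_def K_def[symmetric] \<alpha>_def[symmetric] by (simp add: algebra_simps)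
      finally show ?thesis .
    qed
    then have "(\<Sum>x\<in>I. c x * real (r * (D * (n x - C x) + C x))) =
        (\<Sum>x\<in>I. lam x * M_sc h r D N (tt x)) - (1 - \<alpha>)"
      by (simp add: right_diff_distrib sum_subtractf sum_lam I(4))
    then show "(\<Sum>x\<in>I. c x * real (r * (D * (n x - C x) + C x))) + c0 * real r =
        (\<Sum>x\<in>I. lam x * M_sc h r D N (tt x))"
      using r by (simp add: c0_def)
  qed
  define R1 where "R1 = (\<Sum>x\<in>I. lam x * R1_sc h r D N (M_sc h r D N (tt x)))"
  have R1_ge: "(\<Sum>x\<in>I. c x * real (K choose Suc (tt x))) \<le> R1"
    unfolding R1_def
  proof (rule sum_mono)
    fix x assume x: "x \<in> I"
    \<comment> \<open>One sum serves \<open>t + 1\<close> users, so the server sends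
      \<open>K / (t + 1)\<close> times the size of a coded symbol instead of \<open>K\<close>
      times.\<close>
    have "Suc (tt x) * (K choose Suc (tt x)) = K * C x"
      using t[OF x] Suc_times_binomial_eq[of "K - 1" "tt x"] by (simp add: C_def mult.commute)
    then have "real (Suc (tt x) * (K choose Suc (tt x))) = real (K * C x)" by (rule arg_cong)
    then have "real (K choose Suc (tt x)) = real (C x) * (real K / (real (tt x) + 1))"
      by (simp add: field_simps)
    then have "c x * real (K choose Suc (tt x)) = lam x * (\<alpha> * real K / (real r * (real (tt x) + 1)))"
      using cC[OF x] by (simp flip: mult.assoc)
    also have "\<dots> \<le> lam x * R1_sc h r D N (M_sc h r D N (tt x))"
      unfolding \<alpha>_def K_def using r I(2,3)[OF x] D N by (intro mult_left_mono R1_sc_ge) auto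
    finally show "c x * real (K choose Suc (tt x)) \<le> lam x * R1_sc h r D N (M_sc h r D N (tt x))" .
  qed
  have "0 \<le> (\<Sum>x\<in>I. c x * real (K choose Suc (tt x)))"
    using c by (intro sum_nonneg mult_nonneg_nonneg) auto
  then have R1_nonneg: "0 \<le> R1" using R1_ge by (rule order_trans)
  have nX_le: "real (nX F) \<le> 2 powr (R1 * F)" for F
  proof -
    have "real (nX F) \<le> 2 powr ((\<Sum>x\<in>I. c x * real (K choose Suc (tt x))) * F)"
      using bound[of "\<lambda>x. K choose Suc (tt x)" 0, OF refl, of F] by (simp add: nX_def)
    also have "\<dots> \<le> 2 powr (R1 * F)" using R1_ge by (intro powr_mono mult_right_mono) auto
    finally show ?thesis .
  qed
  have nY_le: "real (nY F) \<le> 2 powr (1 / real r * F)" for F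
  proof -
    have "(\<Sum>x\<in>I. c x * real (C x)) = (\<Sum>x\<in>I. lam x * (\<alpha> / real r))"
      using cC by (intro sum.cong refl) simp
    then have "(\<Sum>x\<in>I. c x * real (C x)) + c0 * real 1 = 1 / real r"
      unfolding sum_lam by (simp add: c0_def diff_divide_distrib)
    from bound[OF this, of F] show ?thesis by (simp add: nY_def)
  qed
  have "(\<lambda>F. real (a F) / 2 ^ F) \<longlonglongrightarrow> 1"
  proof -
    \<comment> \<open>The exponents add up to 1, so \<open>2 ^ F\<close> factors over the components
      and each quotient can tend to 1 on its own.\<close>
    have eq: "real (a F) / 2 ^ F = (\<Prod>x\<in>I. (real (m x F) / 2 powr (c x * real F)) ^ (C x * r)) *
        (real (m0 F) / 2 powr (c0 * real F)) ^ r" for F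
    proof -
      have "(2 :: real) ^ F = 2 powr (((\<Sum>x\<in>I. c x * real (C x * r)) + c0 * real r) * real F)"
        unfolding total by (simp add: powr_realpow)
      also have "\<dots> = 2 powr (\<Sum>x\<in>I. c x * real F * real (C x * r)) * 2 powr (c0 * real F * real r)"
        by (simp add: distrib_left powr_add sum_distrib_left mult_ac)
      also have "\<dots> = (\<Prod>x\<in>I. (2 powr (c x * real F)) ^ (C x * r)) * (2 powr (c0 * real F)) ^ r"
        using I(1) by (simp only: powr_power_eq) (simp add: powr_sum)
      finally show ?thesis
        by (simp add: a_def power_divide prod_dividef flip: power_mult)
    qed
    have "(\<lambda>F. (\<Prod>x\<in>I. (real (m x F) / 2 powr (c x * real F)) ^ (C x * r)) *
        (real (m0 F) / 2 powr (c0 * real F)) ^ r) \<longlonglongrightarrow> (\<Prod>x\<in>I. 1 ^ (C x * r)) * 1 ^ r"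
      unfolding m_def m0_def
      by (intro tendsto_mult tendsto_prod tendsto_power near_pow_ratio_tendsto c c0 B)
    then show ?thesis unfolding eq by simp
  qed
  then have "\<forall>\<^sub>F F in sequentially. 1 - \<epsilon> < real (a F) / 2 ^ F"
    using \<open>0 < \<epsilon>\<close> by (intro order_tendstoD(1)) auto
  then obtain F0 where F0: "\<And>F. F \<ge> F0 \<Longrightarrow> 1 - \<epsilon> < real (a F) / 2 ^ F"
    by (auto simp: eventually_sequentially)
  have "\<exists>q Vc Zc Xs Yf Dec. scheme_ok h r D (\<Sum>x\<in>I. lam x * M_sc h r D N (tt x)) N R1 (1 / real r)
      \<epsilon> \<delta> F q Vc Zc Xs Yf Dec" if "F \<ge> F0" for F
  proof (rule scheme_ok_of_perfect_sizes[OF sizes a_le])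
    show "(1 - \<epsilon>) * 2 ^ F < real (a F)" using F0[OF that] by (simp add: less_divide_eq)
  qed (use nV_le nZ_le nX_le nY_le R1_nonneg \<open>0 < \<delta>\<close> in auto)
  then show "\<exists>F0. \<forall>F\<ge>F0. \<exists>q Vc Zc Xs Yf Dec. scheme_ok h r D (\<Sum>x\<in>I. lam x * M_sc h r D N (tt x)) N
      (\<Sum>x\<in>I. lam x * R1_sc h r D N (M_sc h r D N (tt x))) (1 / real r) \<epsilon> \<delta> F q Vc Zc Xs Yf Dec"
    unfolding R1_def by blast
qed

theorem theorem5:
  fixes h r D :: nat and N :: real
  assumes "0 < r" and "r < h" and "h choose r \<le> D"
    and "0 \<le> N" and "N \<le> (real D + real (Khat h r)) / real r"
  shows "(\<forall>t < Khat h r.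
            achievable_sc h r D (M_sc h r D N t) N (R1_sc h r D N (M_sc h r D N t)) (1 / real r))
       \<and> (\<forall>p \<in> convex hull {(M_sc h r D N t, R1_sc h r D N (M_sc h r D N t), 1 / real r) | t. t < Khat h r}.
            achievable_sc h r D (fst p) N (fst (snd p)) (snd (snd p)))"
proof -
  define pt where "pt t = (M_sc h r D N t, R1_sc h r D N (M_sc h r D N t), 1 / real r)" for t
  have set_eq: "{(M_sc h r D N t, R1_sc h r D N (M_sc h r D N t), 1 / real r) | t. t < Khat h r} = pt ` {..<Khat h r}"
    by (auto simp: pt_def)
  have D: "0 < D" using assms(2,3) by (metis less_imp_le less_le_trans zero_less_binomial_iff)
  have hull: "achievable_sc h r D (fst p) N (fst (snd p)) (snd (snd p))"
    if "p \<in> convex hull (pt ` {..<Khat h r})" for p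
  proof -
    let ?S = "pt ` {..<Khat h r}"
    have "\<exists>lam. (\<forall>x\<in>?S. 0 \<le> lam x) \<and> sum lam ?S = 1 \<and> (\<Sum>x\<in>?S. lam x *\<^sub>R x) = p"
      using that unfolding convex_hull_finite[OF finite_imageI[OF finite_lessThan]] by (rule CollectD)
    then obtain lam where "(\<forall>x\<in>?S. 0 \<le> lam x) \<and> sum lam ?S = 1 \<and> (\<Sum>x\<in>?S. lam x *\<^sub>R x) = p" ..
    then have lam: "\<forall>x\<in>?S. 0 \<le> lam x" "sum lam ?S = 1" "(\<Sum>x\<in>?S. lam x *\<^sub>R x) = p" by simp_all
    \<comment> \<open>Several \<open>t\<close> may give the same point: if
      \<open>\<alpha> = 0\<close>, all of them give \<open>(1, 0, 1 / r)\<close>. Any preimage will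
      do, since only the point enters the sums.\<close>
    define tt where "tt = inv_into {..<Khat h r} pt"
    have tt: "tt x < Khat h r" "pt (tt x) = x" if "x \<in> ?S" for x
      using inv_into_into[OF that] f_inv_into_f[OF that] by (simp_all add: tt_def)
    have comp: "fst x = M_sc h r D N (tt x)" "fst (snd x) = R1_sc h r D N (M_sc h r D N (tt x))"
      "snd (snd x) = 1 / real r" if "x \<in> ?S" for x
      using arg_cong[OF tt(2)[OF that], of fst] arg_cong[OF tt(2)[OF that], of "\<lambda>y. fst (snd y)"]
        arg_cong[OF tt(2)[OF that], of "\<lambda>y. snd (snd y)"] by (simp_all add: pt_def)
    have "fst p = (\<Sum>x\<in>?S. lam x * M_sc h r D N (tt x))"
      "fst (snd p) = (\<Sum>x\<in>?S. lam x * R1_sc h r D N (M_sc h r D N (tt x)))"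
      unfolding lam(3)[symmetric] fst_sum snd_sum by (intro sum.cong refl; simp add: comp)+
    moreover have "snd (snd p) = (\<Sum>x\<in>?S. lam x * (1 / real r))"
      unfolding lam(3)[symmetric] snd_sum by (intro sum.cong refl) (simp add: comp)
    then have "snd (snd p) = 1 / real r" using lam(2) by (simp flip: sum_distrib_right sum_divide_distrib)
    ultimately show ?thesis
      using achievable_time_sharing[OF assms(1) D assms(4,5), of ?S tt lam] tt(1) lam(1,2) by simp
  qed
  moreover have "achievable_sc h r D (M_sc h r D N t) N (R1_sc h r D N (M_sc h r D N t)) (1 / real r)"
    if "t < Khat h r" for t
    using hull[of "pt t"] that hull_inc[of "pt t" "pt ` {..<Khat h r}" convex] by (simp add: pt_def)
  ultimately show ?thesis unfolding set_eq by blast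
qed

end
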